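(* Let $\mathcal{A}^*$ be a formal graded-commutative differential graded algebra over a field of characteristic zero and let $\alpha\in H^1(\mathcal{A}^* )$. Then the deformation spectral sequence $\mathcal{F}^*_r(\mathcal{A}^*,\alpha)$ (with $\mathcal{A}^*$ regarded as a differential graded module over itself) degenerates at its second term $\mathcal{F}^*_2=\mathrm{Ker}\,L_\alpha/\mathrm{Im}\,L_\alpha$, where $L_\alpha:H^*(\mathcal{A}^* )\to H^{*+1}(\mathcal{A}^* )$ is multiplication by $\alpha$; i.e. all differentials $d_r$, $r\geq2$, vanish.
   Context: A DGA is formal if it has the same minimal (Sullivan) model as its cohomology algebra (with zero differential). Deformation spectral sequence for a DG-module $\mathcal{N}^*$ over $\mathcal{A}^*$ and $\alpha=[\xi]$, $\xi\in\mathcal{A}^1$ a cocycle: let $\mathcal{N}^*[[t]]$ be formal power series in $t$ over $\mathcal{N}^*$ with differential $D_tx=dx+t\xi x$; the short exact sequence $0\to\mathcal{N}^*[[t]]\xrightarrow{t}\mathcal{N}^*[[t]]\xrightarrow{\pi}\mathcal{N}^*\to0$ ($\pi$: $t\mapsto0$) yields an exact couple with $D=H^*(\mathcal{N}^*[[t]],D_t)$, $E=H^*(\mathcal{N}^* )$, $i=t$, $j=\pi_*$, $k$ = connecting homomorphism; $\mathcal{F}^*_r(\mathcal{N}^*,\alpha)$ is the spectral sequence of this exact couple (Massey derived couples), which up to isomorphism depends only on $\alpha$. *)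

theory Defs
  imports Main
begin

text \<open>Everything is graded by nat (non-negatively graded, as for Sullivan algebras).
  Each degree n has its own carrier, zero, addition; the differential maps degree n
  to degree n+1.\<close>

record 'a cx =
  cc :: "nat \<Rightarrow> 'a set"
  cz :: "nat \<Rightarrow> 'a"
  ca :: "nat \<Rightarrow> 'a \<Rightarrow> 'a \<Rightarrow> 'a"
  cd :: "nat \<Rightarrow> 'a \<Rightarrow> 'a"

record ('k, 'a) dga = "'a cx" +
  sm :: "nat \<Rightarrow> 'k \<Rightarrow> 'a \<Rightarrow> 'a"
  mu :: "nat \<Rightarrow> nat \<Rightarrow> 'a \<Rightarrow> 'a \<Rightarrow> 'a"
  un :: "'a"

definition vs_ax :: "'a set \<Rightarrow> 'a \<Rightarrow> ('a \<Rightarrow> 'a \<Rightarrow> 'a) \<Rightarrow> ('k::field \<Rightarrow> 'a \<Rightarrow> 'a) \<Rightarrow> bool" where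
  "vs_ax S z a s \<longleftrightarrow> z \<in> S \<and> (\<forall>x\<in>S. \<forall>y\<in>S. a x y \<in> S) \<and> (\<forall>c. \<forall>x\<in>S. s c x \<in> S) \<and>
     (\<forall>x\<in>S. \<forall>y\<in>S. \<forall>w\<in>S. a (a x y) w = a x (a y w)) \<and> (\<forall>x\<in>S. \<forall>y\<in>S. a x y = a y x) \<and>
     (\<forall>x\<in>S. a z x = x) \<and> (\<forall>x\<in>S. a x (s (-1) x) = z) \<and>
     (\<forall>c d. \<forall>x\<in>S. s (c + d) x = a (s c x) (s d x)) \<and>
     (\<forall>c. \<forall>x\<in>S. \<forall>y\<in>S. s c (a x y) = a (s c x) (s c y)) \<and>
     (\<forall>c d. \<forall>x\<in>S. s (c * d) x = s c (s d x)) \<and> (\<forall>x\<in>S. s 1 x = x)"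

definition cdga :: "('k::field, 'a) dga \<Rightarrow> bool" where
  "cdga A \<longleftrightarrow>
     (\<forall>n. vs_ax (cc A n) (cz A n) (ca A n) (sm A n)) \<and>
     (\<forall>m n. \<forall>x\<in>cc A m. \<forall>y\<in>cc A n. mu A m n x y \<in> cc A (m + n)) \<and>
     (\<forall>m n. \<forall>x\<in>cc A m. \<forall>x'\<in>cc A m. \<forall>y\<in>cc A n.
        mu A m n (ca A m x x') y = ca A (m + n) (mu A m n x y) (mu A m n x' y)) \<and>
     (\<forall>m n. \<forall>x\<in>cc A m. \<forall>y\<in>cc A n. \<forall>y'\<in>cc A n.
        mu A m n x (ca A n y y') = ca A (m + n) (mu A m n x y) (mu A m n x y')) \<and>
     (\<forall>m n c. \<forall>x\<in>cc A m. \<forall>y\<in>cc A n.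
        mu A m n (sm A m c x) y = sm A (m + n) c (mu A m n x y) \<and>
        mu A m n x (sm A n c y) = sm A (m + n) c (mu A m n x y)) \<and>
     (\<forall>l m n. \<forall>x\<in>cc A l. \<forall>y\<in>cc A m. \<forall>z\<in>cc A n.
        mu A (l + m) n (mu A l m x y) z = mu A l (m + n) x (mu A m n y z)) \<and>
     un A \<in> cc A 0 \<and>
     (\<forall>n. \<forall>x\<in>cc A n. mu A 0 n (un A) x = x \<and> mu A n 0 x (un A) = x) \<and>
     (\<forall>m n. \<forall>x\<in>cc A m. \<forall>y\<in>cc A n.
        mu A m n x y = sm A (m + n) ((-1) ^ (m * n)) (mu A n m y x)) \<and>
     (\<forall>n. \<forall>x\<in>cc A n. cd A n x \<in> cc A (Suc n)) \<and>
     (\<forall>n. \<forall>x\<in>cc A n. \<forall>y\<in>cc A n. cd A n (ca A n x y) = ca A (Suc n) (cd A n x) (cd A n y)) \<and>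
     (\<forall>n c. \<forall>x\<in>cc A n. cd A n (sm A n c x) = sm A (Suc n) c (cd A n x)) \<and>
     (\<forall>n. \<forall>x\<in>cc A n. cd A (Suc n) (cd A n x) = cz A (Suc (Suc n))) \<and>
     (\<forall>m n. \<forall>x\<in>cc A m. \<forall>y\<in>cc A n.
        cd A (m + n) (mu A m n x y) =
          ca A (Suc (m + n)) (mu A (Suc m) n (cd A m x) y)
             (sm A (Suc (m + n)) ((-1) ^ m) (mu A m (Suc n) x (cd A n y))))"

definition cocycles :: "('a, 'z) cx_scheme \<Rightarrow> nat \<Rightarrow> 'a set" where
  "cocycles C n = {x \<in> cc C n. cd C n x = cz C (Suc n)}"

definition coboundaries :: "('a, 'z) cx_scheme \<Rightarrow> nat \<Rightarrow> 'a set" where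
  "coboundaries C n = (if n = 0 then {cz C 0} else cd C (n - 1) ` cc C (n - 1))"

definition cls :: "('a, 'z) cx_scheme \<Rightarrow> nat \<Rightarrow> 'a \<Rightarrow> 'a set" where
  "cls C n x = {ca C n x b | b. b \<in> coboundaries C n}"

definition H :: "('a, 'z) cx_scheme \<Rightarrow> nat \<Rightarrow> 'a set set" where
  "H C n = cls C n ` cocycles C n"

definition rep :: "'a set \<Rightarrow> 'a" where
  "rep X = (SOME x. x \<in> X)"

definition H_dga :: "('k::field, 'a) dga \<Rightarrow> ('k, 'a set) dga" where
  "H_dga A = \<lparr> cc = H A, cz = (\<lambda>n. cls A n (cz A n)),
     ca = (\<lambda>n X Y. cls A n (ca A n (rep X) (rep Y))),
     cd = (\<lambda>n X. cls A (Suc n) (cz A (Suc n))),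
     sm = (\<lambda>n c X. cls A n (sm A n c (rep X))),
     mu = (\<lambda>m n X Y. cls A (m + n) (mu A m n (rep X) (rep Y))),
     un = cls A 0 (un A) \<rparr>"

definition dga_hom :: "('k::field, 'm) dga \<Rightarrow> ('k, 'a) dga \<Rightarrow> (nat \<Rightarrow> 'm \<Rightarrow> 'a) \<Rightarrow> bool" where
  "dga_hom M A f \<longleftrightarrow>
     (\<forall>n. \<forall>x\<in>cc M n. f n x \<in> cc A n) \<and>
     (\<forall>n. \<forall>x\<in>cc M n. \<forall>y\<in>cc M n. f n (ca M n x y) = ca A n (f n x) (f n y)) \<and>
     (\<forall>n c. \<forall>x\<in>cc M n. f n (sm M n c x) = sm A n c (f n x)) \<and>
     (\<forall>n. \<forall>x\<in>cc M n. f (Suc n) (cd M n x) = cd A n (f n x)) \<and>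
     (\<forall>m n. \<forall>x\<in>cc M m. \<forall>y\<in>cc M n. f (m + n) (mu M m n x y) = mu A m n (f m x) (f n y)) \<and>
     f 0 (un M) = un A"

definition quasi_iso :: "('k::field, 'm) dga \<Rightarrow> ('k, 'a) dga \<Rightarrow> (nat \<Rightarrow> 'm \<Rightarrow> 'a) \<Rightarrow> bool" where
  "quasi_iso M A f \<longleftrightarrow> dga_hom M A f \<and>
     (\<forall>n. bij_betw (\<lambda>X. cls A n (f n (rep X))) (H M n) (H A n))"

fun lc :: "('k, 'a) dga \<Rightarrow> nat \<Rightarrow> ('k \<times> 'a) list \<Rightarrow> 'a" where
  "lc A n [] = cz A n"
| "lc A n ((c, x) # xs) = ca A n (sm A n c x) (lc A n xs)"

definition span_fam :: "('k, 'a) dga \<Rightarrow> nat \<Rightarrow> ('i \<Rightarrow> 'a) \<Rightarrow> 'i set \<Rightarrow> 'a set" where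
  "span_fam A n f S = {lc A n (map (\<lambda>s. (c s, f s)) xs) | xs c. set xs \<subseteq> S}"

definition indep_fam :: "('k::field, 'a) dga \<Rightarrow> nat \<Rightarrow> ('i \<Rightarrow> 'a) \<Rightarrow> 'i set \<Rightarrow> bool" where
  "indep_fam A n f S \<longleftrightarrow> (\<forall>xs c. distinct xs \<longrightarrow> set xs \<subseteq> S \<longrightarrow>
      lc A n (map (\<lambda>s. (c s, f s)) xs) = cz A n \<longrightarrow> (\<forall>s\<in>set xs. c s = 0))"

text \<open>A generator is a pair (v, degree). A monomial is a list of (generator, exponent).\<close>
fun gpow :: "('k, 'a) dga \<Rightarrow> 'a \<Rightarrow> nat \<Rightarrow> nat \<Rightarrow> 'a" where
  "gpow A v d 0 = un A"
| "gpow A v d (Suc e) = mu A d (e * d) v (gpow A v d e)"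

fun mon_deg :: "(('a \<times> nat) \<times> nat) list \<Rightarrow> nat" where
  "mon_deg [] = 0"
| "mon_deg ((g, e) # ms) = e * snd g + mon_deg ms"

fun mon_val :: "('k, 'a) dga \<Rightarrow> (('a \<times> nat) \<times> nat) list \<Rightarrow> 'a" where
  "mon_val A [] = un A"
| "mon_val A ((g, e) # ms) = mu A (e * snd g) (mon_deg ms) (gpow A (fst g) (snd g) e) (mon_val A ms)"

definition word_len :: "(('a \<times> nat) \<times> nat) list \<Rightarrow> nat" where
  "word_len ms = sum_list (map snd ms)"

definition adm_mons :: "('a \<times> nat) set \<Rightarrow> ('a \<times> nat) rel \<Rightarrow> nat \<Rightarrow> (('a \<times> nat) \<times> nat) list set" where
  "adm_mons G r n = {ms. set (map fst ms) \<subseteq> G \<and>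
      sorted_wrt (\<lambda>a b. (a, b) \<in> r \<and> a \<noteq> b) (map fst ms) \<and>
      (\<forall>(g, e)\<in>set ms. 1 \<le> e \<and> (odd (snd g) \<longrightarrow> e = 1)) \<and> mon_deg ms = n}"

text \<open>(M, d) is a minimal Sullivan algebra: M = \<Lambda>V freely graded-commutative on a
  space V = V^{\<ge>1} with a well-ordered homogeneous basis G such that
  d v_\<alpha> \<in> \<Lambda>(v_\<beta> : \<beta> < \<alpha>) and d V \<subseteq> \<Lambda>^{\<ge>2} V.\<close>
definition minimal_sullivan :: "('k::field, 'm) dga \<Rightarrow> bool" where
  "minimal_sullivan M \<longleftrightarrow> (\<exists>G r.
     well_order_on G r \<and>
     (\<forall>(v, d)\<in>G. 1 \<le> d \<and> v \<in> cc M d) \<and>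
     (\<forall>n. indep_fam M n (mon_val M) (adm_mons G r n) \<and>
          cc M n \<subseteq> span_fam M n (mon_val M) (adm_mons G r n)) \<and>
     (\<forall>(v, d)\<in>G. cd M d v \<in> span_fam M (Suc d) (mon_val M)
          {ms \<in> adm_mons G r (Suc d). \<forall>g\<in>set (map fst ms). (g, (v, d)) \<in> r \<and> g \<noteq> (v, d)}) \<and>
     (\<forall>(v, d)\<in>G. cd M d v \<in> span_fam M (Suc d) (mon_val M)
          {ms \<in> adm_mons G r (Suc d). 2 \<le> word_len ms}))"

definition minimal_model :: "('k::field, 'm) dga \<Rightarrow> (nat \<Rightarrow> 'm \<Rightarrow> 'a) \<Rightarrow> ('k, 'a) dga \<Rightarrow> bool" where
  "minimal_model M f A \<longleftrightarrow> cdga M \<and> minimal_sullivan M \<and> quasi_iso M A f"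

record ('d, 'e) ecouple =
  Dc :: "nat \<Rightarrow> 'd set"
  Ec :: "nat \<Rightarrow> 'e set"
  zD :: "nat \<Rightarrow> 'd"
  ii :: "nat \<Rightarrow> 'd \<Rightarrow> 'd"   (* D^n \<rightarrow> D^n *)
  jj :: "nat \<Rightarrow> 'd \<Rightarrow> 'e"   (* D^n \<rightarrow> E^n *)
  kk :: "nat \<Rightarrow> 'e \<Rightarrow> 'd"   (* E^n \<rightarrow> D^{n+1} *)

text \<open>E_r = Z_r / B_r with Z_r = k^{-1}(Im i^{r-1}), B_r = j(Ker i^{r-1}).\<close>
definition ec_Z :: "('d, 'e) ecouple \<Rightarrow> nat \<Rightarrow> nat \<Rightarrow> 'e set" where
  "ec_Z C r n = {x \<in> Ec C n. \<exists>y\<in>Dc C (Suc n). kk C n x = (ii C (Suc n) ^^ (r - 1)) y}"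

definition ec_B :: "('d, 'e) ecouple \<Rightarrow> nat \<Rightarrow> nat \<Rightarrow> 'e set" where
  "ec_B C r n = {jj C n y | y. y \<in> Dc C n \<and> (ii C n ^^ (r - 1)) y = zD C n}"

text \<open>d_r[x] = [j y] where i^{r-1} y = k x; d_r = 0 means all such j y lie in B_r.\<close>
definition dr_vanishes :: "('d, 'e) ecouple \<Rightarrow> nat \<Rightarrow> bool" where
  "dr_vanishes C r \<longleftrightarrow> (\<forall>n. \<forall>x\<in>ec_Z C r n. \<forall>y\<in>Dc C (Suc n).
      kk C n x = (ii C (Suc n) ^^ (r - 1)) y \<longrightarrow> jj C (Suc n) y \<in> ec_B C r (Suc n))"

text \<open>A[[t]] with D_t x = d x + t \<xi> x.\<close>
definition ser_cx :: "('k, 'a) dga \<Rightarrow> 'a \<Rightarrow> (nat \<Rightarrow> 'a) cx" where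
  "ser_cx A \<xi> = \<lparr> cc = (\<lambda>n. {f. \<forall>k. f k \<in> cc A n}),
     cz = (\<lambda>n k. cz A n),
     ca = (\<lambda>n f g k. ca A n (f k) (g k)),
     cd = (\<lambda>n f k. ca A (Suc n) (cd A n (f k))
                    (if k = 0 then cz A (Suc n) else mu A 1 n \<xi> (f (k - 1)))) \<rparr>"

definition tshift :: "('k, 'a) dga \<Rightarrow> nat \<Rightarrow> (nat \<Rightarrow> 'a) \<Rightarrow> (nat \<Rightarrow> 'a)" where
  "tshift A n f = (\<lambda>k. if k = 0 then cz A n else f (k - 1))"

text \<open>i = t_*, j = \<pi>_*, k = connecting homomorphism of 0 \<rightarrow> A[[t]] \<rightarrow> A[[t]] \<rightarrow> A \<rightarrow> 0.\<close>
definition def_couple :: "('k, 'a) dga \<Rightarrow> 'a \<Rightarrow> ((nat \<Rightarrow> 'a) set, 'a set) ecouple" where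
  "def_couple A \<xi> = \<lparr> Dc = H (ser_cx A \<xi>), Ec = H A,
     zD = (\<lambda>n. cls (ser_cx A \<xi>) n (cz (ser_cx A \<xi>) n)),
     ii = (\<lambda>n X. cls (ser_cx A \<xi>) n (tshift A n (rep X))),
     jj = (\<lambda>n X. cls A n (rep X 0)),
     kk = (\<lambda>n X. cls (ser_cx A \<xi>) (Suc n)
             (SOME y. y \<in> cc (ser_cx A \<xi>) (Suc n) \<and>
                (\<exists>c\<in>cc (ser_cx A \<xi>) n. c 0 = rep X \<and> cd (ser_cx A \<xi>) n c = tshift A (Suc n) y))) \<rparr>"

end

theory Submission
  imports Defs
begin

text \<open>
  A class survives to the \<open>r\<close>-th term iff it starts a sequence \<open>c\<^sub>0, \<dots>, c\<^sub>r\<^sub>-\<^sub>1\<close> with \<open>d c\<^sub>0 = 0\<close> and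
  \<open>d c\<^sub>i\<^sub>+\<^sub>1 + \<xi> c\<^sub>i = 0\<close>, and then \<open>d\<^sub>r\<close> sends it to the class of \<open>\<xi> c\<^sub>r\<^sub>-\<^sub>1\<close>. Hence it suffices that this
  class always lies in \<open>\<alpha> H\<^sup>*(A)\<close>. Multiplication by \<open>exp(t h)\<close> replaces \<open>\<xi>\<close> by a cohomologous cocycle
  \<open>\<phi>(\<eta>)\<close>; this is where characteristic zero enters. The sequence is then lifted along \<open>\<phi>\<close> to \<open>M\<close>, with last
  entry \<open>m\<close>. As \<open>H\<^sup>*(A)\<close> has zero differential, \<open>\<psi>(m)\<close> is a cocycle, so \<open>\<psi>(m) = \<psi>(z)\<close> for some cocycle
  \<open>z\<close> of \<open>M\<close>. Then \<open>\<psi>\<close> agrees on the cocycles \<open>\<eta> m\<close> and \<open>\<eta> z\<close>, so these are cohomologous, and the class of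
  \<open>\<xi> c\<^sub>r\<^sub>-\<^sub>1\<close> is \<open>\<alpha>\<close> times the class of \<open>\<phi>(z)\<close>.
\<close>

section \<open>Cochain complexes of abelian groups\<close>

text \<open>Only additive structure is required, so that one treatment of classes serves
  \<open>A\<close>, the series complex (which carries no scalars) and \<open>H_dga A\<close>. The
  record has no inverse operation, whence the existential axiom and a negation defined by
  choice.\<close>

locale cochain_complex =
  fixes C :: "('a, 'z) cx_scheme"
  assumes zero_closed [simp]: "cz C n \<in> cc C n"
    and add_closed [simp]: "x \<in> cc C n \<Longrightarrow> y \<in> cc C n \<Longrightarrow> ca C n x y \<in> cc C n"
    and add_assoc: "x \<in> cc C n \<Longrightarrow> y \<in> cc C n \<Longrightarrow> z \<in> cc C n \<Longrightarrow>
      ca C n (ca C n x y) z = ca C n x (ca C n y z)"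
    and add_comm: "x \<in> cc C n \<Longrightarrow> y \<in> cc C n \<Longrightarrow> ca C n x y = ca C n y x"
    and zero_add [simp]: "x \<in> cc C n \<Longrightarrow> ca C n (cz C n) x = x"
    and add_inverse: "x \<in> cc C n \<Longrightarrow> \<exists>y\<in>cc C n. ca C n x y = cz C n"
    and d_closed [simp]: "x \<in> cc C n \<Longrightarrow> cd C n x \<in> cc C (Suc n)"
    and d_add: "x \<in> cc C n \<Longrightarrow> y \<in> cc C n \<Longrightarrow>
      cd C n (ca C n x y) = ca C (Suc n) (cd C n x) (cd C n y)"
    and d_d [simp]: "x \<in> cc C n \<Longrightarrow> cd C (Suc n) (cd C n x) = cz C (Suc (Suc n))"
begin

definition neg :: "nat \<Rightarrow> 'a \<Rightarrow> 'a" where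
  "neg n x = (SOME y. y \<in> cc C n \<and> ca C n x y = cz C n)"

lemma neg_closed_and_add_neg:
  assumes "x \<in> cc C n"
  shows "neg n x \<in> cc C n \<and> ca C n x (neg n x) = cz C n"
  unfolding neg_def by (rule someI_ex) (use add_inverse[OF assms] in blast)

lemma neg_closed [simp]: "x \<in> cc C n \<Longrightarrow> neg n x \<in> cc C n"
  and add_neg [simp]: "x \<in> cc C n \<Longrightarrow> ca C n x (neg n x) = cz C n"
  using neg_closed_and_add_neg by blast+

lemma add_left_comm:
  "x \<in> cc C n \<Longrightarrow> y \<in> cc C n \<Longrightarrow> z \<in> cc C n \<Longrightarrow>
    ca C n x (ca C n y z) = ca C n y (ca C n x z)"
  by (metis add_assoc add_comm)

lemma add_zero [simp]: "x \<in> cc C n \<Longrightarrow> ca C n x (cz C n) = x"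
  using add_comm by fastforce

lemma neg_add [simp]: "x \<in> cc C n \<Longrightarrow> ca C n (neg n x) x = cz C n"
  using add_comm by fastforce

lemma add_left_imp_eq:
  assumes "x \<in> cc C n" "y \<in> cc C n" "z \<in> cc C n" "ca C n x y = ca C n x z"
  shows "y = z"
  by (metis assms add_assoc neg_add neg_closed zero_add)

text \<open>An additive map sends zero to an element with \<open>x + x = x\<close>. This is how
  differentials, products and algebra maps are seen to preserve zero, which their axioms do not
  state.\<close>

lemma add_self_imp_zero: "x \<in> cc C n \<Longrightarrow> ca C n x x = x \<Longrightarrow> x = cz C n"
  by (metis add_left_imp_eq add_zero zero_closed)

lemma add_neg_cancel [simp]: "x \<in> cc C n \<Longrightarrow> y \<in> cc C n \<Longrightarrow> ca C n x (ca C n (neg n x) y) = y"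
  by (metis add_assoc add_neg neg_closed zero_add)

lemma neg_unique: "x \<in> cc C n \<Longrightarrow> y \<in> cc C n \<Longrightarrow> ca C n x y = cz C n \<Longrightarrow> y = neg n x"
  by (metis add_left_imp_eq add_neg neg_closed)

lemma neg_neg [simp]: "x \<in> cc C n \<Longrightarrow> neg n (neg n x) = x"
  by (metis neg_add neg_closed neg_unique)

lemma d_zero [simp]: "cd C n (cz C n) = cz C (Suc n)"
  by (metis add_self_imp_zero d_add d_closed zero_add zero_closed)

lemma d_neg: "x \<in> cc C n \<Longrightarrow> cd C n (neg n x) = neg (Suc n) (cd C n x)"
  by (metis add_neg d_add d_closed d_zero neg_closed neg_unique)

section \<open>Cocycles, coboundaries and chosen representatives of classes\<close>

lemma cocycle_closed: "x \<in> cocycles C n \<Longrightarrow> x \<in> cc C n"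
  by (simp add: cocycles_def)

lemma coboundary_closed: "b \<in> coboundaries C n \<Longrightarrow> b \<in> cc C n"
  by (cases n) (auto simp: coboundaries_def)

lemma coboundary_is_cocycle: "b \<in> coboundaries C n \<Longrightarrow> b \<in> cocycles C n"
  by (cases n) (auto simp: coboundaries_def cocycles_def)

lemma zero_coboundary [simp]: "cz C n \<in> coboundaries C n"
proof (cases n)
  case (Suc m)
  then have "cz C n = cd C m (cz C m)" by simp
  then show ?thesis by (simp add: coboundaries_def Suc image_iff) (metis zero_closed d_zero)
qed (simp add: coboundaries_def)

lemma d_coboundary [simp]: "x \<in> cc C n \<Longrightarrow> cd C n x \<in> coboundaries C (Suc n)"
  by (simp add: coboundaries_def)

lemma add_coboundary:
  assumes "b \<in> coboundaries C n" "b' \<in> coboundaries C n"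
  shows "ca C n b b' \<in> coboundaries C n"
proof (cases n)
  case (Suc m)
  with assms obtain x y where "x \<in> cc C m" "y \<in> cc C m" "b = cd C m x" "b' = cd C m y"
    by (auto simp: coboundaries_def)
  then show ?thesis using Suc by (metis add_closed d_add d_coboundary)
qed (use assms in \<open>simp add: coboundaries_def\<close>)

lemma neg_coboundary:
  assumes "b \<in> coboundaries C n"
  shows "neg n b \<in> coboundaries C n"
proof (cases n)
  case 0
  then show ?thesis using assms
    by (simp add: coboundaries_def) (metis neg_unique zero_add zero_closed)
next
  case (Suc m)
  with assms obtain x where "x \<in> cc C m" "b = cd C m x"
    by (auto simp: coboundaries_def)
  then show ?thesis using Suc by (metis neg_closed d_neg d_coboundary)
qed

lemma zero_cocycle [simp]: "cz C n \<in> cocycles C n"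
  by (simp add: cocycles_def)

lemma add_cocycle: "x \<in> cocycles C n \<Longrightarrow> y \<in> cocycles C n \<Longrightarrow> ca C n x y \<in> cocycles C n"
  by (simp add: cocycles_def d_add)

lemma cls_add_coboundary:
  assumes "x \<in> cc C n" "b \<in> coboundaries C n"
  shows "cls C n (ca C n x b) = cls C n x"
proof -
  have b: "b \<in> cc C n" using assms coboundary_closed by blast
  show ?thesis
  proof
    show "cls C n (ca C n x b) \<subseteq> cls C n x"
      using assms b add_assoc add_coboundary coboundary_closed by (fastforce simp: cls_def)
    show "cls C n x \<subseteq> cls C n (ca C n x b)"
    proof
      fix y assume "y \<in> cls C n x"
      then obtain b' where b': "b' \<in> coboundaries C n" "y = ca C n x b'" by (auto simp: cls_def)
      have b'c: "b' \<in> cc C n" using b' coboundary_closed by blast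
      have "y = ca C n (ca C n x b) (ca C n (neg n b) b')"
        using b'(2) b'c b assms(1) by (simp add: add_assoc)
      then show "y \<in> cls C n (ca C n x b)"
        using add_coboundary neg_coboundary assms(2) b'(1) by (auto simp: cls_def)
    qed
  qed
qed

lemma cls_add_coboundary_left:
  "x \<in> cc C n \<Longrightarrow> b \<in> coboundaries C n \<Longrightarrow> cls C n (ca C n b x) = cls C n x"
  by (metis add_comm cls_add_coboundary coboundary_closed)

lemma mem_cls: "x \<in> cc C n \<Longrightarrow> x \<in> cls C n x"
  unfolding cls_def using zero_coboundary by (metis (mono_tags, lifting) add_zero mem_Collect_eq)

lemma cls_eqD:
  assumes "x \<in> cc C n" "cls C n x = cls C n y"
  obtains b where "b \<in> coboundaries C n" "x = ca C n y b"
  using mem_cls[OF assms(1)] assms(2) that by (auto simp: cls_def)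

lemma cls_eq_zero_iff:
  assumes "x \<in> cc C n"
  shows "cls C n x = cls C n (cz C n) \<longleftrightarrow> x \<in> coboundaries C n"
  by (metis assms cls_add_coboundary cls_eqD coboundary_closed zero_add zero_closed)

lemma rep_cls:
  assumes "x \<in> cc C n"
  obtains b where "b \<in> coboundaries C n" "rep (cls C n x) = ca C n x b"
proof -
  have "rep (cls C n x) \<in> cls C n x"
    unfolding rep_def by (rule someI) (rule mem_cls[OF assms])
  then show ?thesis using that by (auto simp: cls_def)
qed

lemma cls_rep_cls: "x \<in> cc C n \<Longrightarrow> cls C n (rep (cls C n x)) = cls C n x"
  by (metis cls_add_coboundary rep_cls)

lemma rep_cocycle: "X \<in> H C n \<Longrightarrow> rep X \<in> cocycles C n"
proof -
  assume "X \<in> H C n"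
  then obtain x where x: "x \<in> cocycles C n" "X = cls C n x" by (auto simp: H_def)
  then obtain b where "b \<in> coboundaries C n" "rep X = ca C n x b"
    using rep_cls cocycle_closed by metis
  then show ?thesis using x add_cocycle coboundary_is_cocycle by simp
qed

lemma cls_rep: "X \<in> H C n \<Longrightarrow> cls C n (rep X) = X"
  unfolding H_def using cls_rep_cls cocycle_closed by auto

lemma cls_in_H: "x \<in> cocycles C n \<Longrightarrow> cls C n x \<in> H C n"
  by (simp add: H_def)

text \<open>The left side is the addition of \<open>H_dga\<close> unfolded: the two choices made by
  \<open>rep\<close> alter the sum only by a coboundary.\<close>

lemma cls_add:
  assumes "x \<in> cc C n" "y \<in> cc C n"
  shows "cls C n (ca C n (rep (cls C n x)) (rep (cls C n y))) = cls C n (ca C n x y)"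
proof -
  obtain b b' where b: "b \<in> coboundaries C n" "rep (cls C n x) = ca C n x b"
      "b' \<in> coboundaries C n" "rep (cls C n y) = ca C n y b'"
    using rep_cls assms by metis
  then have "ca C n (rep (cls C n x)) (rep (cls C n y)) = ca C n (ca C n x y) (ca C n b b')"
    using assms coboundary_closed by (simp add: add_assoc add_left_comm)
  then show ?thesis using b assms by (simp add: add_coboundary cls_add_coboundary)
qed

end

section \<open>Quasi-isomorphisms\<close>

text \<open>The two algebras enter as complexes only, so that \<open>H_dga A\<close> can be a target
  once its additive structure is known; multiplicativity is part of
  \<open>quasi_iso\<close>.\<close>

locale quasi_isomorphism = source: cochain_complex M + target: cochain_complex B
  for M :: "('k::field, 'm) dga" and B :: "('k, 'b) dga" +
  fixes f :: "nat \<Rightarrow> 'm \<Rightarrow> 'b"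
  assumes quasi_iso: "quasi_iso M B f"
begin

lemma hom: "dga_hom M B f"
  using quasi_iso by (simp add: quasi_iso_def)

lemma hom_closed [simp]: "x \<in> cc M n \<Longrightarrow> f n x \<in> cc B n"
  and hom_add: "x \<in> cc M n \<Longrightarrow> y \<in> cc M n \<Longrightarrow> f n (ca M n x y) = ca B n (f n x) (f n y)"
  and hom_d: "x \<in> cc M n \<Longrightarrow> f (Suc n) (cd M n x) = cd B n (f n x)"
  and hom_mult: "x \<in> cc M m \<Longrightarrow> y \<in> cc M n \<Longrightarrow> f (m + n) (mu M m n x y) = mu B m n (f m x) (f n y)"
  using hom unfolding dga_hom_def by blast+

lemma hom_zero [simp]: "f n (cz M n) = cz B n"
  by (metis hom_add hom_closed source.zero_add source.zero_closed target.add_self_imp_zero)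

lemma hom_neg: "x \<in> cc M n \<Longrightarrow> f n (source.neg n x) = target.neg n (f n x)"
  by (metis hom_add hom_closed hom_zero source.add_neg source.neg_closed target.neg_unique)

lemma hom_cocycle: "x \<in> cocycles M n \<Longrightarrow> f n x \<in> cocycles B n"
  unfolding cocycles_def by (simp flip: hom_d)

lemma hom_coboundary: "b \<in> coboundaries M n \<Longrightarrow> f n b \<in> coboundaries B n"
  by (cases n) (auto simp: coboundaries_def hom_d)

text \<open>The cohomology map inside \<open>quasi_iso\<close> goes through \<open>rep\<close>. The
  representative differs by a coboundary, which \<open>f\<close> maps to a coboundary, so
  bijectivity can be used on arbitrary cocycles.\<close>

lemma cls_hom_rep:
  assumes "x \<in> cc M n"
  shows "cls B n (f n (rep (cls M n x))) = cls B n (f n x)"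
  by (metis assms hom_add hom_closed hom_coboundary source.coboundary_closed source.rep_cls
      target.cls_add_coboundary)

lemma hom_cls_cong:
  "x \<in> cc M n \<Longrightarrow> y \<in> cc M n \<Longrightarrow> cls M n x = cls M n y \<Longrightarrow> cls B n (f n x) = cls B n (f n y)"
  by (metis cls_hom_rep)

lemma lift_cocycle:
  assumes "y \<in> cocycles B n"
  obtains x where "x \<in> cocycles M n" "cls B n (f n x) = cls B n y"
proof -
  have "cls B n y \<in> (\<lambda>X. cls B n (f n (rep X))) ` H M n"
    using quasi_iso assms target.cls_in_H by (auto simp: quasi_iso_def bij_betw_def)
  then show ?thesis using that source.rep_cocycle by auto
qed

lemma hom_cls_inject:
  assumes "x \<in> cocycles M n" "y \<in> cocycles M n" "cls B n (f n x) = cls B n (f n y)"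
  shows "cls M n x = cls M n y"
proof -
  have "inj_on (\<lambda>X. cls B n (f n (rep X))) (H M n)"
    using quasi_iso by (auto simp: quasi_iso_def bij_betw_def)
  then show ?thesis
    by (rule inj_onD)
      (use assms source.cocycle_closed source.cls_in_H in \<open>auto simp: cls_hom_rep\<close>)
qed

end

section \<open>Multiplication by a degree-one cocycle\<close>

locale cdg_algebra =
  fixes A :: "('k::field_char_0, 'a) dga"
  assumes cdga: "cdga A"
begin

lemma vector_space: "vs_ax (cc A n) (cz A n) (ca A n) (sm A n)"
  using cdga unfolding cdga_def by meson

lemma scale_closed [simp]: "x \<in> cc A n \<Longrightarrow> sm A n c x \<in> cc A n"
  and scale_add_left: "x \<in> cc A n \<Longrightarrow> sm A n (c + c') x = ca A n (sm A n c x) (sm A n c' x)"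
  and scale_add_right: "x \<in> cc A n \<Longrightarrow> y \<in> cc A n \<Longrightarrow>
    sm A n c (ca A n x y) = ca A n (sm A n c x) (sm A n c y)"
  and scale_scale: "x \<in> cc A n \<Longrightarrow> sm A n (c * c') x = sm A n c (sm A n c' x)"
  and scale_one [simp]: "x \<in> cc A n \<Longrightarrow> sm A n 1 x = x"
  and add_scale_minus_one: "x \<in> cc A n \<Longrightarrow> ca A n x (sm A n (-1) x) = cz A n"
  using vector_space[of n] unfolding vs_ax_def by blast+

sublocale cochain_complex A
proof
  show "\<exists>y\<in>cc A n. ca A n x y = cz A n" if "x \<in> cc A n" for n x
    using that add_scale_minus_one scale_closed by blast
  show "cd A n x \<in> cc A (Suc n)" if "x \<in> cc A n" for n x
    using cdga that unfolding cdga_def by meson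
  show "cd A n (ca A n x y) = ca A (Suc n) (cd A n x) (cd A n y)"
    if "x \<in> cc A n" "y \<in> cc A n" for n x y
    using cdga that unfolding cdga_def by meson
  show "cd A (Suc n) (cd A n x) = cz A (Suc (Suc n))" if "x \<in> cc A n" for n x
    using cdga that unfolding cdga_def by meson
  fix n x y z
  show "cz A n \<in> cc A n"
    using vector_space[of n] unfolding vs_ax_def by blast
  show "ca A n x y \<in> cc A n" if "x \<in> cc A n" "y \<in> cc A n"
    using vector_space[of n] that unfolding vs_ax_def by meson
  show "ca A n (ca A n x y) z = ca A n x (ca A n y z)"
    if "x \<in> cc A n" "y \<in> cc A n" "z \<in> cc A n"
    using vector_space[of n] that unfolding vs_ax_def by meson
  show "ca A n x y = ca A n y x" if "x \<in> cc A n" "y \<in> cc A n"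
    using vector_space[of n] that unfolding vs_ax_def by meson
  show "ca A n (cz A n) x = x" if "x \<in> cc A n"
    using vector_space[of n] that unfolding vs_ax_def by meson
qed

lemma mult_closed: "x \<in> cc A m \<Longrightarrow> y \<in> cc A n \<Longrightarrow> mu A m n x y \<in> cc A (m + n)"
  and mult_add_left: "x \<in> cc A m \<Longrightarrow> x' \<in> cc A m \<Longrightarrow> y \<in> cc A n \<Longrightarrow>
    mu A m n (ca A m x x') y = ca A (m + n) (mu A m n x y) (mu A m n x' y)"
  and mult_add_right: "x \<in> cc A m \<Longrightarrow> y \<in> cc A n \<Longrightarrow> y' \<in> cc A n \<Longrightarrow>
    mu A m n x (ca A n y y') = ca A (m + n) (mu A m n x y) (mu A m n x y')"
  and mult_scale_left: "x \<in> cc A m \<Longrightarrow> y \<in> cc A n \<Longrightarrow>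
    mu A m n (sm A m c x) y = sm A (m + n) c (mu A m n x y)"
  and mult_assoc: "x \<in> cc A l \<Longrightarrow> y \<in> cc A m \<Longrightarrow> z \<in> cc A n \<Longrightarrow>
    mu A (l + m) n (mu A l m x y) z = mu A l (m + n) x (mu A m n y z)"
  and mult_comm: "x \<in> cc A m \<Longrightarrow> y \<in> cc A n \<Longrightarrow>
    mu A m n x y = sm A (m + n) ((-1) ^ (m * n)) (mu A n m y x)"
  using cdga unfolding cdga_def by meson+

lemma unit_closed [simp]: "un A \<in> cc A 0"
  and unit_mult [simp]: "x \<in> cc A n \<Longrightarrow> mu A 0 n (un A) x = x"
  and mult_unit [simp]: "x \<in> cc A n \<Longrightarrow> mu A n 0 x (un A) = x"
  and d_scale: "x \<in> cc A n \<Longrightarrow> cd A n (sm A n c x) = sm A (Suc n) c (cd A n x)"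
  and leibniz: "x \<in> cc A m \<Longrightarrow> y \<in> cc A n \<Longrightarrow> cd A (m + n) (mu A m n x y) =
    ca A (Suc (m + n)) (mu A (Suc m) n (cd A m x) y)
      (sm A (Suc (m + n)) ((-1) ^ m) (mu A m (Suc n) x (cd A n y)))"
  using cdga unfolding cdga_def by meson+

lemma scale_zero [simp]: "sm A n c (cz A n) = cz A n"
  by (metis add_self_imp_zero scale_add_right scale_closed zero_add zero_closed)

lemma mult_zero [simp]: "x \<in> cc A m \<Longrightarrow> mu A m n x (cz A n) = cz A (m + n)"
  by (metis add_self_imp_zero mult_add_right mult_closed zero_add zero_closed)

lemma zero_mult [simp]: "x \<in> cc A n \<Longrightarrow> mu A m n (cz A m) x = cz A (m + n)"
  by (metis add_self_imp_zero mult_add_left mult_closed zero_add zero_closed)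

lemma scale_minus_one: "x \<in> cc A n \<Longrightarrow> sm A n (-1) x = neg n x"
  by (simp add: add_scale_minus_one neg_unique)

text \<open>Division by 2; this turns anticommutativity into vanishing squares.\<close>

lemma double_eq_zero:
  assumes "x \<in> cc A n" "ca A n x x = cz A n"
  shows "x = cz A n"
proof -
  have "sm A n (1 + 1) x = cz A n" using assms by (simp only: scale_add_left scale_one)
  then have "sm A n ((1 / 2) * (1 + 1)) x = cz A n" by (simp only: scale_scale assms scale_zero)
  then show ?thesis using assms by simp
qed

text \<open>Stated separately so that the degrees \<open>0 + n\<close> and \<open>1 + n\<close> appear as \<open>n\<close> and \<open>Suc n\<close>.\<close>

definition mult0 :: "nat \<Rightarrow> 'a \<Rightarrow> 'a \<Rightarrow> 'a" where
  "mult0 n a x = mu A 0 n a x"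

definition mult1 :: "nat \<Rightarrow> 'a \<Rightarrow> 'a \<Rightarrow> 'a" where
  "mult1 n a x = mu A 1 n a x"

lemma mult0_closed [simp]: "a \<in> cc A 0 \<Longrightarrow> x \<in> cc A n \<Longrightarrow> mult0 n a x \<in> cc A n"
  and mult1_closed [simp]: "u \<in> cc A 1 \<Longrightarrow> x \<in> cc A n \<Longrightarrow> mult1 n u x \<in> cc A (Suc n)"
  using mult_closed[of a 0 x n] mult_closed[of u 1 x n] by (simp_all add: mult0_def mult1_def)

lemma mult0_add: "a \<in> cc A 0 \<Longrightarrow> x \<in> cc A n \<Longrightarrow> y \<in> cc A n \<Longrightarrow>
    mult0 n a (ca A n x y) = ca A n (mult0 n a x) (mult0 n a y)"
  and mult1_add: "u \<in> cc A 1 \<Longrightarrow> x \<in> cc A n \<Longrightarrow> y \<in> cc A n \<Longrightarrow>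
    mult1 n u (ca A n x y) = ca A (Suc n) (mult1 n u x) (mult1 n u y)"
  using mult_add_right[of a 0 x n y] mult_add_right[of u 1 x n y]
  by (simp_all add: mult0_def mult1_def)

lemma mult1_add_left: "u \<in> cc A 1 \<Longrightarrow> v \<in> cc A 1 \<Longrightarrow> x \<in> cc A n \<Longrightarrow>
    mult1 n (ca A 1 u v) x = ca A (Suc n) (mult1 n u x) (mult1 n v x)"
  using mult_add_left[of u 1 v x n] by (simp add: mult1_def)

lemma mult0_zero [simp]: "a \<in> cc A 0 \<Longrightarrow> mult0 n a (cz A n) = cz A n"
  and mult1_zero [simp]: "u \<in> cc A 1 \<Longrightarrow> mult1 n u (cz A n) = cz A (Suc n)"
  using mult_zero[of a 0 n] mult_zero[of u 1 n] by (simp_all add: mult0_def mult1_def)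

lemma mult1_neg: "u \<in> cc A 1 \<Longrightarrow> x \<in> cc A n \<Longrightarrow> mult1 n u (neg n x) = neg (Suc n) (mult1 n u x)"
  by (metis add_neg mult1_add mult1_closed mult1_zero neg_closed neg_unique)

lemma mult0_mult1:
  assumes "a \<in> cc A 0" "u \<in> cc A 1" "x \<in> cc A n"
  shows "mult1 n (mult0 1 a u) x = mult0 (Suc n) a (mult1 n u x)"
  using mult_assoc[of a 0 u 1 x n] assms by (simp add: mult0_def mult1_def)

lemma mult1_mult0_eq:
  assumes "a \<in> cc A 0" "u \<in> cc A 1"
  shows "mult1 0 u a = mult0 1 a u"
  using mult_comm[of u 1 a 0] mult_closed[of a 0 u 1] assms by (simp add: mult0_def mult1_def)

lemma mult1_mult0:
  assumes "a \<in> cc A 0" "u \<in> cc A 1" "x \<in> cc A n"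
  shows "mult1 n u (mult0 n a x) = mult0 (Suc n) a (mult1 n u x)"
  using mult_assoc[of u 1 a 0 x n] mult0_mult1[OF assms] mult1_mult0_eq[OF assms(1,2)] assms
  by (simp add: mult0_def mult1_def)

lemma mult0_mult0:
  "a \<in> cc A 0 \<Longrightarrow> b \<in> cc A 0 \<Longrightarrow> x \<in> cc A n \<Longrightarrow> mult0 n (mult0 0 a b) x = mult0 n a (mult0 n b x)"
  using mult_assoc[of a 0 b 0 x n] by (simp add: mult0_def)

lemma mult0_scale_left:
  "a \<in> cc A 0 \<Longrightarrow> x \<in> cc A n \<Longrightarrow> mult0 n (sm A 0 c a) x = sm A n c (mult0 n a x)"
  using mult_scale_left[of a 0 x n c] by (simp add: mult0_def)

lemma mult0_unit [simp]: "x \<in> cc A n \<Longrightarrow> mult0 n (un A) x = x"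
  by (simp add: mult0_def)

lemma d_mult0:
  assumes "a \<in> cc A 0" "x \<in> cc A n"
  shows "cd A n (mult0 n a x) = ca A (Suc n) (mult1 n (cd A 0 a) x) (mult0 (Suc n) a (cd A n x))"
  using leibniz[of a 0 x n] assms mult_closed[of a 0 "cd A n x" "Suc n"]
  by (simp add: mult0_def mult1_def)

lemma d_mult1:
  assumes "u \<in> cocycles A 1" "x \<in> cc A n"
  shows "cd A (Suc n) (mult1 n u x) = neg (Suc (Suc n)) (mult1 (Suc n) u (cd A n x))"
proof -
  have u: "u \<in> cc A 1" "cd A 1 u = cz A 2" using assms(1) by (simp_all add: cocycles_def numeral_2_eq_2)
  show ?thesis
    using leibniz[of u 1 x n] u assms mult1_closed[of u "cd A n x" "Suc n"] mult_closed[of u 1 "cd A n x" "Suc n"]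
    by (simp add: mult1_def numeral_2_eq_2 scale_minus_one)
qed

text \<open>Graded commutativity gives \<open>2 u\<^sup>2 = 0\<close> in odd degree.\<close>
lemma mult1_mult1 [simp]:
  assumes "u \<in> cc A 1" "x \<in> cc A n"
  shows "mult1 (Suc n) u (mult1 n u x) = cz A (Suc (Suc n))"
proof -
  let ?s = "mu A 1 1 u u"
  have s: "?s \<in> cc A 2" using mult_closed[of u 1 u 1] assms by (simp add: numeral_2_eq_2)
  have "?s = neg 2 ?s"
    using mult_comm[of u 1 u 1] assms s scale_minus_one[OF s] by (simp add: numeral_2_eq_2)
  then have "?s = cz A 2" using double_eq_zero[OF s] add_neg[OF s] by simp
  then show ?thesis
    using mult_assoc[of u 1 u 1 x n] assms by (simp add: mult1_def numeral_2_eq_2)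
qed

lemma mult1_cocycle:
  assumes "u \<in> cocycles A 1" "x \<in> cocycles A n"
  shows "mult1 n u x \<in> cocycles A (Suc n)"
proof -
  have "u \<in> cc A 1" "x \<in> cc A n" "cd A n x = cz A (Suc n)" using assms by (auto simp: cocycles_def)
  then show ?thesis using d_mult1[OF assms(1), of x n]
    by (simp add: cocycles_def flip: mult1_neg) (metis mult1_zero neg_unique zero_add zero_closed)
qed

text \<open>For \<open>b = d a\<close> the witness is \<open>w = - u a\<close>: since
  \<open>u\<close> is an odd cocycle, \<open>d w = u (d a)\<close>, and \<open>u w = 0\<close>
  because \<open>u u = 0\<close>. The latter is what the invariant of \<open>lift_chain_end\<close>
  asks for.\<close>

lemma mult1_coboundary:
  assumes "u \<in> cocycles A 1" "b \<in> coboundaries A n"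
  obtains w where "w \<in> cc A n" "mult1 n u w = cz A (Suc n)" "cd A n w = mult1 n u b"
proof (cases n)
  case 0
  then show ?thesis using assms that[of "cz A n"] by (simp add: coboundaries_def cocycles_def)
next
  case (Suc m)
  then obtain a where a: "a \<in> cc A m" "b = cd A m a" using assms(2) by (auto simp: coboundaries_def)
  have u: "u \<in> cc A 1" using assms(1) by (simp add: cocycles_def)
  show ?thesis
  proof (rule that)
    show "neg n (mult1 m u a) \<in> cc A n" using u a Suc by simp
    show "mult1 n u (neg n (mult1 m u a)) = cz A (Suc n)"
      using u a Suc by (simp add: mult1_neg) (metis neg_unique zero_add zero_closed)
    show "cd A n (neg n (mult1 m u a)) = mult1 n u b"
      using u a Suc d_mult1[OF assms(1)] by (simp add: d_neg)
  qed
qed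

lemma mult1_coboundary_closed:
  "u \<in> cocycles A 1 \<Longrightarrow> b \<in> coboundaries A n \<Longrightarrow> mult1 n u b \<in> coboundaries A (Suc n)"
  by (metis d_coboundary mult1_coboundary)

text \<open>\<open>d (h x) = (d h) x\<close> when \<open>d x = 0\<close>; hence replacing a
  degree-one cocycle by a cohomologous one changes its product with \<open>x\<close> by a
  coboundary.\<close>

lemma mult1_d_left:
  assumes "h \<in> cc A 0" "x \<in> cocycles A n"
  shows "mult1 n (cd A 0 h) x \<in> coboundaries A (Suc n)"
proof -
  have "cd A n (mult0 n h x) = mult1 n (cd A 0 h) x"
    using d_mult0[of h x n] assms by (simp add: cocycles_def)
  then show ?thesis using assms by (metis cocycle_closed d_coboundary mult0_closed)
qed

section \<open>Iterated Massey products with a degree-one cocycle\<close>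

text \<open>The last entry \<open>c\<^sub>k\<close> of a sequence with \<open>d c\<^sub>0 = 0\<close> and \<open>d c\<^sub>i\<^sub>+\<^sub>1 + u c\<^sub>i = 0\<close>, i.e. of a
  \<open>D\<^sub>t\<close>-cocycle modulo \<open>t\<^sup>k\<^sup>+\<^sup>1\<close>.\<close>
inductive chain_end :: "'a \<Rightarrow> nat \<Rightarrow> 'a \<Rightarrow> bool" for u :: 'a and n :: nat where
  cocycle: "c \<in> cocycles A n \<Longrightarrow> chain_end u n c"
| step: "chain_end u n c \<Longrightarrow> c' \<in> cc A n \<Longrightarrow> ca A (Suc n) (cd A n c') (mult1 n u c) = cz A (Suc n)
    \<Longrightarrow> chain_end u n c'"

lemma chain_end_closed: "chain_end u n c \<Longrightarrow> c \<in> cc A n"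
  by (induction rule: chain_end.induct) (auto simp: cocycles_def)

section \<open>Divided powers \<open>h^j / j!\<close> and multiplication by
  \<open>exp(t h)\<close>\<close>

primrec divided_power :: "'a \<Rightarrow> nat \<Rightarrow> 'a" where
  "divided_power h 0 = un A"
| "divided_power h (Suc j) = sm A 0 (1 / of_nat (Suc j)) (mult0 0 h (divided_power h j))"

lemma divided_power_closed [simp]: "h \<in> cc A 0 \<Longrightarrow> divided_power h j \<in> cc A 0"
  by (induction j) auto

lemma mult_divided_power:
  assumes "h \<in> cc A 0"
  shows "mult0 0 h (divided_power h j) = sm A 0 (of_nat (Suc j)) (divided_power h (Suc j))"
proof -
  have "sm A 0 (of_nat (Suc j)) (divided_power h (Suc j))
      = sm A 0 (of_nat (Suc j) * (1 / of_nat (Suc j))) (mult0 0 h (divided_power h j))"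
    using assms by (simp only: divided_power.simps scale_scale mult0_closed divided_power_closed)
  also have "of_nat (Suc j) * (1 / of_nat (Suc j)) = (1::'k)"
    by (simp del: of_nat_Suc)
  finally show ?thesis using assms by simp
qed

text \<open>Coefficientwise form of \<open>d exp(t h) = t exp(t h) dh\<close>. With
  \<open>y = h^(j+1)/(j+1)! dh\<close>, the Leibniz rule gives one copy of \<open>y\<close> and the
  induction hypothesis \<open>j+1\<close> more; the factor \<open>1/(j+2)\<close> cancels their
  number.\<close>

lemma d_divided_power:
  assumes "h \<in> cc A 0"
  shows "cd A 0 (divided_power h (Suc j)) = mult0 1 (divided_power h j) (cd A 0 h)"
proof (induction j)
  case 0
  have "mult0 0 h (un A) = h" using assms by (simp add: mult0_def)
  then show ?case using assms d_closed[OF assms] by simp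
next
  case (Suc j)
  let ?e = "divided_power h" and ?dh = "cd A 0 h"
  have dh: "?dh \<in> cc A 1" using d_closed[OF assms] by simp
  let ?y = "mult0 1 (?e (Suc j)) ?dh"
  have y: "?y \<in> cc A 1" using assms dh by (simp del: divided_power.simps)
  have "cd A 0 (mult0 0 h (?e (Suc j))) = ca A 1 (mult1 0 ?dh (?e (Suc j))) (mult0 1 h (cd A 0 (?e (Suc j))))"
    using d_mult0[of h "?e (Suc j)" 0] assms by (simp del: divided_power.simps)
  also have "mult1 0 ?dh (?e (Suc j)) = ?y"
    using mult1_mult0_eq[of "?e (Suc j)" ?dh] assms dh by (simp del: divided_power.simps)
  also have "mult0 1 h (cd A 0 (?e (Suc j))) = mult0 1 (mult0 0 h (?e j)) ?dh"
    unfolding Suc using assms dh by (simp add: mult0_mult0)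
  also have "\<dots> = sm A 1 (of_nat (Suc j)) ?y"
    using assms dh by (simp add: mult_divided_power mult0_scale_left del: divided_power.simps of_nat_Suc)
  also have "ca A 1 ?y (sm A 1 (of_nat (Suc j)) ?y) = sm A 1 (of_nat (Suc (Suc j))) ?y"
    using y scale_add_left[of ?y 1 1 "of_nat (Suc j)"] by (simp del: divided_power.simps)
  finally have eq: "cd A 0 (mult0 0 h (?e (Suc j))) = sm A 1 (of_nat (Suc (Suc j))) ?y" .
  have "cd A 0 (?e (Suc (Suc j))) = sm A 1 (1 / of_nat (Suc (Suc j))) (cd A 0 (mult0 0 h (?e (Suc j))))"
    using assms d_scale[of "mult0 0 h (?e (Suc j))" 0]
    by (simp only: divided_power.simps(2)[of h "Suc j"] mult0_closed divided_power_closed One_nat_def)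
  also have "\<dots> = sm A 1 (1 / of_nat (Suc (Suc j)) * of_nat (Suc (Suc j))) ?y"
    using y by (simp only: eq scale_scale)
  also have "1 / of_nat (Suc (Suc j)) * of_nat (Suc (Suc j)) = (1::'k)"
    by (simp del: of_nat_Suc)
  finally show ?case using y by (simp only: scale_one)
qed

lemma d_mult_divided_power:
  assumes "h \<in> cc A 0" "x \<in> cc A n"
  shows "cd A n (mult0 n (divided_power h (Suc j)) x) =
    ca A (Suc n) (mult0 (Suc n) (divided_power h j) (mult1 n (cd A 0 h) x))
      (mult0 (Suc n) (divided_power h (Suc j)) (cd A n x))"
proof -
  have dh: "cd A 0 h \<in> cc A 1" using d_closed[OF assms(1)] by simp
  show ?thesis
    using d_mult0[of "divided_power h (Suc j)" x n] d_divided_power[OF assms(1)] mult0_mult1[OF _ dh assms(2)] assms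
    by (simp del: divided_power.simps)
qed

text \<open>Multiplication by \<open>exp(t h)\<close> turns the differential \<open>d + t u\<close> with \<open>u = v + dh\<close> into \<open>d + t v\<close>.
  For a chain \<open>c\<^sub>0, \<dots>, c\<^sub>k\<close> the witness is \<open>q j = (\<Sum>i. h\<^sup>i\<^sup>+\<^sup>j / (i+j)! c\<^sub>k\<^sub>-\<^sub>i)\<close>; carrying all \<open>j\<close> along makes
  the statement inductive in the last entry alone.\<close>
lemma chain_end_change_cocycle:
  assumes h: "h \<in> cc A 0" and v: "v \<in> cc A 1" and u: "u = ca A 1 v (cd A 0 h)"
    and "chain_end u n c"
  shows "\<exists>q. (\<forall>j. q j \<in> cc A n) \<and> chain_end v n (q 0) \<and>
    (\<forall>j. ca A (Suc n) (cd A n (q (Suc j))) (mult1 n v (q j))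
       = mult0 (Suc n) (divided_power h j) (mult1 n u c))"
  using assms(4)
proof (induction rule: chain_end.induct)
  let ?e = "divided_power h" and ?dh = "cd A 0 h"
  have dh: "?dh \<in> cc A 1" using d_closed[OF h] by simp
  have uc: "u \<in> cc A 1" using u v dh by simp
  \<comment> \<open>Degree-zero factors pass through multiplication by \<open>v\<close> without a
    sign, so the contributions of \<open>dh\<close> and \<open>v\<close> recombine to
    \<open>u\<close>.\<close>
  have split: "ca A (Suc n) (mult0 (Suc n) (?e j) (mult1 n ?dh x)) (mult1 n v (mult0 n (?e j) x))
      = mult0 (Suc n) (?e j) (mult1 n u x)" if "x \<in> cc A n" for j x
    using that h v dh mult1_add_left[OF v dh that]
    by (simp add: u mult0_add mult1_mult0 add_comm)
  {
    case (cocycle c)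
    then have c: "c \<in> cc A n" "cd A n c = cz A (Suc n)" by (simp_all add: cocycles_def)
    show ?case
    proof (intro exI conjI allI)
      show "mult0 n (?e j) c \<in> cc A n" for j using h c by simp
      show "chain_end v n (mult0 n (?e 0) c)" using cocycle c by (simp add: chain_end.cocycle)
      show "ca A (Suc n) (cd A n (mult0 n (?e (Suc j)) c)) (mult1 n v (mult0 n (?e j) c))
        = mult0 (Suc n) (?e j) (mult1 n u c)" for j
        using split[OF c(1), of j] h c dh by (simp add: d_mult_divided_power del: divided_power.simps)
    qed
  next
    case (step c c')
    then obtain q where q: "\<And>j. q j \<in> cc A n" "chain_end v n (q 0)"
      "\<And>j. ca A (Suc n) (cd A n (q (Suc j))) (mult1 n v (q j)) = mult0 (Suc n) (?e j) (mult1 n u c)"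
      by blast
    have c: "c \<in> cc A n" "c' \<in> cc A n" using step chain_end_closed by auto
    \<comment> \<open>Appending \<open>c'\<close> raises the index of every older entry by one: the
      summand \<open>i = 0\<close> is the new \<open>c'\<close> term, and the remaining sum is the
      old \<open>q\<close> at \<open>j + 1\<close>.\<close>
    let ?q = "\<lambda>j. ca A n (mult0 n (?e j) c') (q (Suc j))"
    show ?case
    proof (intro exI conjI allI)
      show "?q j \<in> cc A n" for j using h c q by simp
      \<comment> \<open>As \<open>?e 0\<close> is the unit, the hypothesis on \<open>q\<close> at
        \<open>j = 0\<close> reduces the left side to \<open>d c' + u c\<close>.\<close>
      have "ca A (Suc n) (cd A n (?q 0)) (mult1 n v (q 0)) = cz A (Suc n)"
        using c q(1) q(3)[of 0] v uc step(3) by (simp add: d_add add_assoc)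
      then show "chain_end v n (?q 0)"
        using h c q(1) by (intro chain_end.step[OF q(2)]) simp_all
      fix j
      \<comment> \<open>The first group is handled by \<open>split\<close>; the second is
        \<open>?e (Suc j)\<close> times \<open>d c' + u c\<close>, which vanishes.\<close>
      have "ca A (Suc n) (cd A n (?q (Suc j))) (mult1 n v (?q j))
        = ca A (Suc n)
            (ca A (Suc n) (mult0 (Suc n) (?e j) (mult1 n ?dh c')) (mult1 n v (mult0 n (?e j) c')))
            (ca A (Suc n) (mult0 (Suc n) (?e (Suc j)) (cd A n c'))
              (ca A (Suc n) (cd A n (q (Suc (Suc j)))) (mult1 n v (q (Suc j)))))"
        using h c q(1) v dh
        by (simp add: d_add mult1_add d_mult_divided_power add_assoc add_left_comm del: divided_power.simps)
      also have "\<dots> = ca A (Suc n) (mult0 (Suc n) (?e j) (mult1 n u c'))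
          (mult0 (Suc n) (?e (Suc j)) (ca A (Suc n) (cd A n c') (mult1 n u c)))"
        using h c uc by (simp add: split q(3) mult0_add del: divided_power.simps)
      also have "\<dots> = mult0 (Suc n) (?e j) (mult1 n u c')"
        using h c uc by (simp add: step(3) del: divided_power.simps)
      finally show "ca A (Suc n) (cd A n (?q (Suc j))) (mult1 n v (?q j))
        = mult0 (Suc n) (?e j) (mult1 n u c')" .
    qed
  }
qed

end

section \<open>Lifting chains along a quasi-isomorphism\<close>

locale cdga_quasi_isomorphism = source: cdg_algebra M + target: cdg_algebra A + quasi_isomorphism M A f
  for M :: "('k::field_char_0, 'm) dga" and A :: "('k, 'a) dga" and f
begin

lemma hom_mult1: "u \<in> cc M 1 \<Longrightarrow> x \<in> cc M n \<Longrightarrow>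
    f (Suc n) (source.mult1 n u x) = target.mult1 n (f 1 u) (f n x)"
  using hom_mult[of u 1 x n] by (simp add: source.mult1_def target.mult1_def)

text \<open>The invariant on \<open>w\<close> encodes that the chain in \<open>A\<close> and the image of the chain in \<open>M\<close> differ by a
  \<open>D\<^sub>t\<close>-coboundary \<open>d h\<^sub>k + f(u) h\<^sub>k\<^sub>-\<^sub>1\<close> (with \<open>w = f(u) h\<^sub>k\<close>), without mentioning elements of degree \<open>n - 1\<close>.\<close>
lemma lift_chain_end:
  assumes u: "u \<in> cocycles M 1" and "target.chain_end (f 1 u) n c"
  shows "\<exists>m\<in>cc M n. source.mult1 n u m \<in> cocycles M (Suc n) \<and>
    (\<exists>w\<in>cc A n. target.mult1 n (f 1 u) w = cz A (Suc n) \<and>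
      ca A (Suc n) (target.mult1 n (f 1 u) c) (cd A n w) = f (Suc n) (source.mult1 n u m))"
  using assms(2)
proof (induction rule: target.chain_end.induct)
  let ?v = "f 1 u"
  have uc: "u \<in> cc M 1" and v: "?v \<in> cocycles A 1" and vc: "?v \<in> cc A 1"
    using u hom_cocycle source.cocycle_closed by auto
  {
    case (cocycle c)
    then have c: "c \<in> cc A n" by (simp add: cocycles_def)
    obtain z where z: "z \<in> cocycles M n" "cls A n (f n z) = cls A n c"
      using lift_cocycle cocycle by blast
    have zc: "z \<in> cc M n" using z by (simp add: cocycles_def)
    obtain b where b: "b \<in> coboundaries A n" "f n z = ca A n c b"
      using target.cls_eqD z zc hom_closed by metis
    \<comment> \<open>The lift \<open>f z\<close> misses \<open>c\<close> by the coboundary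
      \<open>b\<close>; \<open>d w = f(u) b\<close> records this error after multiplication.\<close>
    obtain w where "w \<in> cc A n" "target.mult1 n ?v w = cz A (Suc n)" "cd A n w = target.mult1 n ?v b"
      using target.mult1_coboundary[OF v b(1)] by blast
    moreover have "source.mult1 n u z \<in> cocycles M (Suc n)"
      by (rule source.mult1_cocycle[OF u z(1)])
    ultimately show ?case
      using zc uc c b vc target.coboundary_closed[OF b(1)]
      by (intro bexI[of _ z] conjI bexI[of _ w]) (simp_all add: hom_mult1 target.mult1_add)
  next
    case (step c c')
    then obtain m w where m: "m \<in> cc M n" "source.mult1 n u m \<in> cocycles M (Suc n)"
      and w: "w \<in> cc A n" "target.mult1 n ?v w = cz A (Suc n)"
        "ca A (Suc n) (target.mult1 n ?v c) (cd A n w) = f (Suc n) (source.mult1 n u m)"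
      by blast
    have c: "c \<in> cc A n" "c' \<in> cc A n" using step target.chain_end_closed by auto
    have mult_c: "target.mult1 n ?v c = target.neg (Suc n) (cd A n c')"
      using step(3) c vc target.neg_unique by simp
    \<comment> \<open>Since \<open>f(u) c = - d c'\<close>, the image of \<open>u m\<close> is
      exact; injectivity on cohomology then makes \<open>u m\<close> exact in \<open>M\<close>, say
      \<open>u m = d p\<close>.\<close>
    have "cls A (Suc n) (f (Suc n) (source.mult1 n u m)) = cls A (Suc n) (f (Suc n) (cz M (Suc n)))"
      unfolding w(3)[symmetric] mult_c
      using c w(1) target.neg_coboundary target.cls_eq_zero_iff target.add_coboundary by simp
    then have "cls M (Suc n) (source.mult1 n u m) = cls M (Suc n) (cz M (Suc n))"
      using hom_cls_inject m(2) source.zero_cocycle by blast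
    then have "source.mult1 n u m \<in> coboundaries M (Suc n)"
      using source.cls_eq_zero_iff m(1) uc by simp
    then obtain p where p: "p \<in> cc M n" "source.mult1 n u m = cd M n p"
      by (auto simp: coboundaries_def)
    \<comment> \<open>The provisional next entry in \<open>M\<close> is \<open>- p\<close>. Its
      image differs from \<open>c'\<close> by \<open>c' + f p\<close>, and subtracting
      \<open>w\<close> turns this into a cocycle. Lifting its class to \<open>z\<close> corrects the
      entry to \<open>z - p\<close>.\<close>
    let ?x = "ca A n (ca A n c' (f n p)) (target.neg n w)"
    have x: "?x \<in> cc A n" using c p w by simp
    have "cd A n ?x = ca A (Suc n) (ca A (Suc n) (cd A n c') (ca A (Suc n) (target.mult1 n ?v c) (cd A n w)))
        (target.neg (Suc n) (cd A n w))"
      using c p w by (simp add: target.d_add target.d_neg flip: hom_d)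
    also have "\<dots> = cz A (Suc n)"
      unfolding mult_c using c w(1) by simp
    finally have "?x \<in> cocycles A n" using x by (simp add: cocycles_def)
    then obtain z where z: "z \<in> cocycles M n" "cls A n (f n z) = cls A n ?x"
      using lift_cocycle by blast
    have zc: "z \<in> cc M n" using z by (simp add: cocycles_def)
    obtain b where b: "b \<in> coboundaries A n" "f n z = ca A n ?x b"
      using target.cls_eqD z zc hom_closed by metis
    have bc: "b \<in> cc A n" using b target.coboundary_closed by blast
    obtain w' where w': "w' \<in> cc A n" "target.mult1 n ?v w' = cz A (Suc n)"
      "cd A n w' = target.mult1 n ?v b"
      using target.mult1_coboundary[OF v b(1)] by blast
    let ?m = "ca M n z (source.neg n p)"
    have m': "?m \<in> cc M n" using zc p by simp
    have "cd M n ?m = source.neg (Suc n) (source.mult1 n u m)"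
      using z zc p m uc by (simp add: source.d_add source.d_neg cocycles_def)
    \<comment> \<open>\<open>d (u m') = - u (d m') = u (u m) = 0\<close> for the new entry
      \<open>m'\<close>.\<close>
    then have "cd M (Suc n) (source.mult1 n u ?m) = cz M (Suc (Suc n))"
      using source.d_mult1[OF u m'] uc m by (simp add: source.mult1_neg)
    then have 1: "source.mult1 n u ?m \<in> cocycles M (Suc n)"
      using uc m' by (simp add: cocycles_def)
    have neg0: "target.neg (Suc n) (cz A (Suc n)) = cz A (Suc n)"
      by (metis target.neg_unique target.zero_add target.zero_closed)
    let ?P = "target.mult1 n ?v (f n p)"
    have "f (Suc n) (source.mult1 n u ?m)
       = ca A (Suc n) (target.mult1 n ?v (f n z)) (target.neg (Suc n) ?P)"
      using uc m' zc p vc by (simp add: hom_mult1 hom_add hom_neg target.mult1_add target.mult1_neg)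
    \<comment> \<open>The term with \<open>w\<close> disappears by \<open>f(u) w = 0\<close>, and
      the \<open>?P\<close> terms cancel next, leaving \<open>f(u) c' + f(u) b\<close>.\<close>
    also have "target.mult1 n ?v (f n z) = ca A (Suc n) ?P
        (ca A (Suc n) (target.mult1 n ?v c') (target.mult1 n ?v b))"
      using b(2) c p w bc vc
      by (simp add: target.mult1_add target.mult1_neg neg0 target.add_assoc target.add_left_comm)
    also have "ca A (Suc n) \<dots> (target.neg (Suc n) ?P)
       = ca A (Suc n) (target.mult1 n ?v c') (target.mult1 n ?v b)"
      using c p bc vc
      by (metis hom_closed target.add_closed target.add_comm target.add_neg_cancel target.mult1_closed
          target.neg_closed target.add_assoc)
    finally have "ca A (Suc n) (target.mult1 n ?v c') (cd A n w') = f (Suc n) (source.mult1 n u ?m)"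
      unfolding w'(3) ..
    then show ?case
      by (intro bexI[of _ ?m] conjI bexI[of _ w'] 1 m' w'(1,2))
  }
qed

end

section \<open>The cohomology algebra\<close>

context cdg_algebra
begin

lemma H_dga_simps [simp]:
  "cc (H_dga A) = H A" "cz (H_dga A) n = cls A n (cz A n)"
  "ca (H_dga A) n X Y = cls A n (ca A n (rep X) (rep Y))"
  "cd (H_dga A) n X = cls A (Suc n) (cz A (Suc n))"
  by (simp_all add: H_dga_def)

text \<open>Since sums of classes are formed from chosen representatives, each group law is
  transported from \<open>A\<close> by rewriting classes as \<open>cls A n x\<close> for explicit
  \<open>x\<close>.\<close>

lemma H_dga_cochain_complex: "cochain_complex (H_dga A)"
proof
  fix n X Y Z
  have sum: "ca (H_dga A) n (cls A n x) (cls A n y) = cls A n (ca A n x y)"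
    if "x \<in> cc A n" "y \<in> cc A n" for x y
    using cls_add[OF that] by simp
  have elem: "\<exists>x. x \<in> cocycles A n \<and> x \<in> cc A n \<and> X = cls A n x" if "X \<in> H A n" for X
    using that by (auto simp: H_def cocycles_def)
  show zero: "cz (H_dga A) n \<in> cc (H_dga A) n" for n
    by (simp add: cls_in_H)
  show "ca (H_dga A) n X Y \<in> cc (H_dga A) n"
    if "X \<in> cc (H_dga A) n" "Y \<in> cc (H_dga A) n" for n X Y
    using that by (simp add: cls_in_H add_cocycle rep_cocycle)
  show "ca (H_dga A) n (ca (H_dga A) n X Y) Z = ca (H_dga A) n X (ca (H_dga A) n Y Z)"
    if XYZ: "X \<in> cc (H_dga A) n" "Y \<in> cc (H_dga A) n" "Z \<in> cc (H_dga A) n"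
  proof -
    obtain x y z where x: "x \<in> cc A n" "y \<in> cc A n" "z \<in> cc A n"
      and X: "X = cls A n x" "Y = cls A n y" "Z = cls A n z"
      using XYZ[unfolded H_dga_simps, THEN elem] by blast
    show ?thesis
      unfolding X sum[OF x(1,2)] sum[OF x(2,3)] sum[OF add_closed[OF x(1,2)] x(3)]
        sum[OF x(1) add_closed[OF x(2,3)]] add_assoc[OF x] ..
  qed
  show "ca (H_dga A) n X Y = ca (H_dga A) n Y X"
    if "X \<in> cc (H_dga A) n" "Y \<in> cc (H_dga A) n"
    using that add_comm[of "rep X" n "rep Y"] cocycle_closed[OF rep_cocycle] by simp
  show "ca (H_dga A) n (cz (H_dga A) n) X = X" if XH: "X \<in> cc (H_dga A) n"
  proof -
    obtain x where x: "x \<in> cc A n" and X: "X = cls A n x"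
      using XH[unfolded H_dga_simps, THEN elem] by blast
    show ?thesis unfolding X H_dga_simps(2) sum[OF zero_closed x] zero_add[OF x] ..
  qed
  show "\<exists>Y\<in>cc (H_dga A) n. ca (H_dga A) n X Y = cz (H_dga A) n" if XH: "X \<in> cc (H_dga A) n"
  proof -
    obtain x where x: "x \<in> cocycles A n" "x \<in> cc A n" "X = cls A n x"
      using XH[unfolded H_dga_simps, THEN elem] by blast
    then have "neg n x \<in> cocycles A n"
      by (simp add: cocycles_def d_neg) (metis neg_unique zero_add zero_closed)
    then have "cls A n (neg n x) \<in> cc (H_dga A) n" by (simp add: cls_in_H)
    moreover have "ca (H_dga A) n X (cls A n (neg n x)) = cz (H_dga A) n"
      unfolding x(3) sum[OF x(2) neg_closed[OF x(2)]] add_neg[OF x(2)] H_dga_simps(2) ..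
    ultimately show ?thesis by blast
  qed
  show "cd (H_dga A) n X \<in> cc (H_dga A) (Suc n)" using zero by simp
  show "cd (H_dga A) n (ca (H_dga A) n X Y) = ca (H_dga A) (Suc n) (cd (H_dga A) n X) (cd (H_dga A) n Y)"
    using cls_add[of "cz A (Suc n)" "Suc n" "cz A (Suc n)"] by simp
  show "cd (H_dga A) (Suc n) (cd (H_dga A) n X) = cz (H_dga A) (Suc (Suc n))" by simp
qed

lemma coboundaries_H_dga: "coboundaries (H_dga A) n = {cz (H_dga A) n}"
proof (cases n)
  case (Suc m)
  \<comment> \<open>The differential is constant, so its image is a singleton only because the
    carrier is nonempty.\<close>
  have "H A m \<noteq> {}" using cls_in_H zero_cocycle by blast
  then show ?thesis by (auto simp: coboundaries_def Suc)
qed (simp add: coboundaries_def)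

lemma cocycles_H_dga: "cocycles (H_dga A) n = H A n"
  by (simp add: cocycles_def)

text \<open>The representative of the class of \<open>u\<close> has the form \<open>u + d h\<close>,
  and \<open>(d h) x\<close> is exact for the cocycle \<open>x = rep X\<close>.\<close>

lemma mult_H_dga:
  assumes u: "u \<in> cocycles A 1" and X: "X \<in> H A n"
  shows "mu (H_dga A) 1 n (cls A 1 u) X = cls A (Suc n) (mult1 n u (rep X))"
proof -
  have uc: "u \<in> cc A 1" and x: "rep X \<in> cocycles A n" and xc: "rep X \<in> cc A n"
    using u X rep_cocycle cocycle_closed by blast+
  obtain b where b: "b \<in> coboundaries A 1" "rep (cls A 1 u) = ca A 1 u b"
    using rep_cls[OF uc] by blast
  then obtain h where h: "h \<in> cc A 0" "b = cd A 0 h"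
    by (auto simp: coboundaries_def)
  have dh: "cd A 0 h \<in> cc A 1" using d_closed[OF h(1)] by simp
  have "mu (H_dga A) 1 n (cls A 1 u) X = cls A (Suc n) (mult1 n (ca A 1 u (cd A 0 h)) (rep X))"
    using b h by (simp add: H_dga_def mult1_def)
  also have "\<dots> = cls A (Suc n) (mult1 n u (rep X))"
    unfolding mult1_add_left[OF uc dh xc]
    using uc xc mult1_d_left[OF h(1) x] by (simp add: cls_add_coboundary)
  finally show ?thesis .
qed

lemma mult_H_dga_cls:
  assumes u: "u \<in> cocycles A 1" and x: "x \<in> cocycles A n"
  shows "mu (H_dga A) 1 n (cls A 1 u) (cls A n x) = cls A (Suc n) (mult1 n u x)"
proof -
  have uc: "u \<in> cc A 1" and xc: "x \<in> cc A n" using u x cocycle_closed by blast+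
  obtain b where b: "b \<in> coboundaries A n" "rep (cls A n x) = ca A n x b"
    using rep_cls[OF xc] by blast
  have "mu (H_dga A) 1 n (cls A 1 u) (cls A n x) = cls A (Suc n) (mult1 n u (ca A n x b))"
    using mult_H_dga[OF u cls_in_H[OF x]] b(2) by simp
  also have "\<dots> = cls A (Suc n) (mult1 n u x)"
    unfolding mult1_add[OF uc xc coboundary_closed[OF b(1)]]
    by (rule cls_add_coboundary[OF mult1_closed[OF uc xc] mult1_coboundary_closed[OF u b(1)]])
  finally show ?thesis .
qed

end

section \<open>Formality: comparing the two quasi-isomorphisms out of \<open>M\<close>\<close>

lemma formal_mult_chain_end:
  fixes A :: "('k::field_char_0, 'a) dga" and M :: "('k, 'm) dga"
  assumes A: "cdga A" and M: "cdga M" and f: "quasi_iso M A f" and g: "quasi_iso M (H_dga A) g"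
    and u: "u \<in> cocycles A 1" and c: "cdg_algebra.chain_end A u n c"
  shows "\<exists>x\<in>cocycles A n. cls A (Suc n) (cdg_algebra.mult1 A n u c)
    = cls A (Suc n) (cdg_algebra.mult1 A n u x)"
proof -
  interpret A: cdg_algebra A by unfold_locales (rule A)
  interpret M: cdg_algebra M by unfold_locales (rule M)
  interpret HA: cochain_complex "H_dga A" by (rule A.H_dga_cochain_complex)
  interpret f: cdga_quasi_isomorphism M A f by unfold_locales (rule f)
  interpret g: quasi_isomorphism M "H_dga A" g by unfold_locales (rule g)
  have uc: "u \<in> cc A 1" using u A.cocycle_closed by blast
  obtain v where v: "v \<in> cocycles M 1" "cls A 1 (f 1 v) = cls A 1 u"
    using f.lift_cocycle[OF u] by blast
  have vc: "v \<in> cc M 1" using v M.cocycle_closed by blast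
  have fv: "f 1 v \<in> cc A 1" using f.hom_closed[OF vc] .
  obtain b where b: "b \<in> coboundaries A 1" "u = ca A 1 (f 1 v) b"
    using A.cls_eqD[OF uc v(2)[symmetric]] by blast
  then obtain h where h: "h \<in> cc A 0" "b = cd A 0 h"
    by (auto simp: coboundaries_def)
  have dh: "cd A 0 h \<in> cc A 1" using A.d_closed[OF h(1)] by simp
  have u_eq: "u = ca A 1 (f 1 v) (cd A 0 h)" using b h by simp
  have cc: "c \<in> cc A n" using c A.chain_end_closed by blast
  obtain q where q: "\<And>j. q j \<in> cc A n" "A.chain_end (f 1 v) n (q 0)"
    "\<And>j. ca A (Suc n) (cd A n (q (Suc j))) (A.mult1 n (f 1 v) (q j))
      = A.mult0 (Suc n) (A.divided_power h j) (A.mult1 n u c)"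
    using A.chain_end_change_cocycle[OF h(1) fv u_eq c] by blast
  obtain m w where m: "m \<in> cc M n" "M.mult1 n v m \<in> cocycles M (Suc n)"
    and w: "w \<in> cc A n"
      "ca A (Suc n) (A.mult1 n (f 1 v) (q 0)) (cd A n w) = f (Suc n) (M.mult1 n v m)"
    using f.lift_chain_end[OF v(1) q(2)] by blast
  \<comment> \<open>\<open>m\<close> need not be a cocycle, but \<open>g m\<close> is one, the
    differential of \<open>H_dga A\<close> being zero.\<close>
  have gm: "g n m \<in> cc (H_dga A) n" using g.hom_closed[OF m(1)] .
  then have "g n m \<in> cocycles (H_dga A) n" by (simp add: A.cocycles_H_dga)
  then obtain z where z: "z \<in> cocycles M n" "cls (H_dga A) n (g n z) = cls (H_dga A) n (g n m)"
    using g.lift_cocycle by blast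
  have zc: "z \<in> cc M n" using z M.cocycle_closed by blast
  \<comment> \<open>The only coboundary of \<open>H_dga A\<close> is zero, so equality of classes is
    equality of elements.\<close>
  have "g n z = g n m"
    using HA.cls_eqD[OF g.hom_closed[OF zc] z(2)] gm HA.add_zero A.coboundaries_H_dga
    by (metis singletonD)
  then have "g (Suc n) (M.mult1 n v z) = g (Suc n) (M.mult1 n v m)"
    using g.hom_mult[OF vc zc] g.hom_mult[OF vc m(1)] by (simp add: M.mult1_def)
  \<comment> \<open>Although \<open>m\<close> and \<open>z\<close> themselves are not compared in
    cohomology, \<open>v m\<close> and \<open>v z\<close> are both cocycles, with equal images under
    the multiplicative map \<open>g\<close>.\<close>
  then have "cls M (Suc n) (M.mult1 n v m) = cls M (Suc n) (M.mult1 n v z)"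
    using m(2) M.mult1_cocycle[OF v(1) z(1)] by (intro g.hom_cls_inject) simp_all
  then have eq: "cls A (Suc n) (f (Suc n) (M.mult1 n v m)) = cls A (Suc n) (f (Suc n) (M.mult1 n v z))"
    using f.hom_cls_cong vc m zc by simp
  have fz: "f n z \<in> cocycles A n" using f.hom_cocycle z by blast
  have fzc: "f n z \<in> cc A n" using fz A.cocycle_closed by blast
  \<comment> \<open>At \<open>j = 0\<close> the divided power is the unit, so \<open>u c\<close> and
    \<open>f(v) (q 0)\<close> differ by the coboundary \<open>d (q 1)\<close>.\<close>
  have "cls A (Suc n) (A.mult1 n u c) = cls A (Suc n) (A.mult1 n (f 1 v) (q 0))"
    using q(3)[of 0] q(1) uc cc fv A.cls_add_coboundary_left[of "A.mult1 n (f 1 v) (q 0)" "Suc n" "cd A n (q (Suc 0))"]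
    by simp
  also have "\<dots> = cls A (Suc n) (f (Suc n) (M.mult1 n v m))"
    using A.cls_add_coboundary[of "A.mult1 n (f 1 v) (q 0)" "Suc n" "cd A n w"] w q(1) fv by simp
  also have "\<dots> = cls A (Suc n) (A.mult1 n (f 1 v) (f n z))"
    unfolding eq using f.hom_mult1[OF vc zc] by simp
  also have "\<dots> = cls A (Suc n) (A.mult1 n u (f n z))"
    unfolding u_eq A.mult1_add_left[OF fv dh fzc]
    using fv fzc A.mult1_d_left[OF h(1) fz] by (simp add: A.cls_add_coboundary)
  finally show ?thesis using fz by blast
qed

section \<open>The deformation exact couple\<close>

lemma tshift_simps [simp]: "tshift A n f 0 = cz A n" "tshift A n f (Suc k) = f k"
  by (simp_all add: tshift_def)

lemma tshift_inject [simp]: "tshift A n f = tshift A n g \<longleftrightarrow> f = g"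
  by (metis ext tshift_simps(2))

lemma tshift_pow: "(tshift A n ^^ s) f k = (if k < s then cz A n else f (k - s))"
  by (induction s arbitrary: k) (auto simp: tshift_def)

locale deformation = cdg_algebra A for A :: "('k::field_char_0, 'a) dga" +
  fixes u :: 'a
  assumes u: "u \<in> cocycles A 1"
begin

abbreviation S :: "(nat \<Rightarrow> 'a) cx" where "S \<equiv> ser_cx A u"

lemma u_closed: "u \<in> cc A 1"
  using u cocycle_closed by blast

lemma mult_u [simp]: "x \<in> cc A n \<Longrightarrow> mult1 n u x \<in> cc A (Suc n)"
  "mult1 n u (cz A n) = cz A (Suc n)"
  "x \<in> cc A n \<Longrightarrow> mult1 (Suc n) u (mult1 n u x) = cz A (Suc (Suc n))"
  using u_closed by auto

lemma ser_simps [simp]: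
  "f \<in> cc S n \<longleftrightarrow> (\<forall>k. f k \<in> cc A n)"
  "cz S n = (\<lambda>k. cz A n)"
  "ca S n f g = (\<lambda>k. ca A n (f k) (g k))"
  by (simp_all add: ser_cx_def)

lemma ser_d_0 [simp]: "f 0 \<in> cc A n \<Longrightarrow> cd S n f 0 = cd A n (f 0)"
  and ser_d_Suc [simp]: "cd S n f (Suc k) = ca A (Suc n) (cd A n (f (Suc k))) (mult1 n u (f k))"
  by (simp_all add: ser_cx_def mult1_def)

sublocale ser: cochain_complex S
proof
  fix n f g and h :: "nat \<Rightarrow> 'a"
  show "\<exists>g\<in>cc S n. ca S n f g = cz S n" if "f \<in> cc S n"
    using that by (intro bexI[of _ "\<lambda>k. neg n (f k)"]) auto
  show "ca S n (ca S n f g) h = ca S n f (ca S n g h)"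
    if "f \<in> cc S n" "g \<in> cc S n" "h \<in> cc S n"
    using that by (simp add: add_assoc)
  show "ca S n f g = ca S n g f" if "f \<in> cc S n" "g \<in> cc S n"
    using that by (simp add: add_comm)
  show "cd S n f \<in> cc S (Suc n)" if "f \<in> cc S n"
  proof -
    have "cd S n f k \<in> cc A (Suc n)" for k using that by (cases k) auto
    then show ?thesis by simp
  qed
  show "cd S n (ca S n f g) = ca S (Suc n) (cd S n f) (cd S n g)"
    if "f \<in> cc S n" "g \<in> cc S n"
  proof
    show "cd S n (ca S n f g) k = ca S (Suc n) (cd S n f) (cd S n g) k" for k
      using that u_closed by (cases k) (auto simp: d_add mult1_add add_assoc add_left_comm)
  qed
  show "cd S (Suc n) (cd S n f) = cz S (Suc (Suc n))" if "f \<in> cc S n"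
  proof
    show "cd S (Suc n) (cd S n f) k = cz S (Suc (Suc n)) k" for k
    proof (cases k)
      case (Suc j)
      \<comment> \<open>The part of the differential containing \<open>u\<close> is killed by
        \<open>u u = 0\<close>; what remains cancels against
        \<open>d (u f_j) = - u (d f_j)\<close>.\<close>
      have "mult1 (Suc n) u (cd S n f j) = mult1 (Suc n) u (cd A n (f j))"
        using that u_closed by (cases j) (auto simp: mult1_add)
      then show ?thesis using that Suc d_mult1[OF u] u_closed by (simp add: d_add)
    qed (use that in simp)
  qed
qed auto

lemma tshift_closed [simp]: "f \<in> cc S n \<Longrightarrow> tshift A n f \<in> cc S n"
  by (simp add: tshift_def)

lemma tshift_add: "tshift A n (ca S n f g) = ca S n (tshift A n f) (tshift A n g)"
  by (auto simp: tshift_def)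

lemma tshift_zero [simp]: "tshift A n (cz S n) = cz S n"
  by (auto simp: tshift_def)

lemma d_tshift:
  assumes "f \<in> cc S n"
  shows "cd S n (tshift A n f) = tshift A (Suc n) (cd S n f)"
proof
  show "cd S n (tshift A n f) k = tshift A (Suc n) (cd S n f) k" for k
  proof (cases k)
    case (Suc j)
    then show ?thesis using assms by (cases j) auto
  qed simp
qed

text \<open>\<open>D_t (t f) = D_t (D_t c) = 0\<close>, and multiplication by \<open>t\<close> is
  injective and commutes with \<open>D_t\<close>.\<close>

lemma cocycle_if_tshift_coboundary:
  assumes "f \<in> cc S (Suc n)" "c \<in> cc S n" "cd S n c = tshift A (Suc n) f"
  shows "f \<in> cocycles S (Suc n)"
proof -
  have "tshift A (Suc (Suc n)) (cd S (Suc n) f) = tshift A (Suc (Suc n)) (cz S (Suc (Suc n)))"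
    unfolding tshift_zero d_tshift[OF assms(1), symmetric] assms(3)[symmetric]
    by (rule ser.d_d[OF assms(2)])
  then show ?thesis using assms(1) unfolding tshift_inject cocycles_def by blast
qed

lemma tshift_coboundary: "b \<in> coboundaries S n \<Longrightarrow> tshift A n b \<in> coboundaries S n"
proof (cases n)
  case (Suc m)
  assume "b \<in> coboundaries S n"
  then obtain g where "g \<in> cc S m" "b = cd S m g" by (auto simp: coboundaries_def Suc)
  then show ?thesis using Suc ser.d_coboundary by (metis d_tshift tshift_closed)
qed (simp add: coboundaries_def del: ser_simps)

section \<open>The maps of the exact couple in terms of series\<close>

lemma couple_simps [simp]:
  "Dc (def_couple A u) = H S" "Ec (def_couple A u) = H A"
  "zD (def_couple A u) n = cls S n (cz S n)"
  "ii (def_couple A u) n X = cls S n (tshift A n (rep X))"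
  "jj (def_couple A u) n X = cls A n (rep X 0)"
  by (simp_all add: def_couple_def)

lemma ii_cls:
  assumes "f \<in> cc S n"
  shows "ii (def_couple A u) n (cls S n f) = cls S n (tshift A n f)"
proof -
  obtain b where b: "b \<in> coboundaries S n" "rep (cls S n f) = ca S n f b"
    using ser.rep_cls[OF assms] by blast
  have "cls S n (ca S n (tshift A n f) (tshift A n b)) = cls S n (tshift A n f)"
    by (rule ser.cls_add_coboundary[OF tshift_closed[OF assms] tshift_coboundary[OF b(1)]])
  then show ?thesis using b(2) by (simp only: couple_simps tshift_add)
qed

lemma tshift_pow_closed: "f \<in> cc S n \<Longrightarrow> (tshift A n ^^ s) f \<in> cc S n"
  by (induction s) (auto simp del: ser_simps)

lemma ii_pow_cls:
  assumes "f \<in> cc S n"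
  shows "(ii (def_couple A u) n ^^ s) (cls S n f) = cls S n ((tshift A n ^^ s) f)"
  using assms by (induction s) (simp_all add: ii_cls tshift_pow_closed del: ser_simps couple_simps)

lemma jj_cls:
  assumes "f \<in> cc S n"
  shows "jj (def_couple A u) n (cls S n f) = cls A n (f 0)"
proof -
  obtain b where b: "b \<in> coboundaries S n" "rep (cls S n f) = ca S n f b"
    using ser.rep_cls[OF assms] by blast
  have "b 0 \<in> coboundaries A n"
    using b(1) by (cases n) (auto simp: coboundaries_def)
  then show ?thesis using assms b(2) by (simp add: cls_add_coboundary)
qed

lemma kk_rep:
  assumes "X \<in> H A n"
  obtains y c where "y \<in> cc S (Suc n)" "c \<in> cc S n" "c 0 = rep X" "cd S n c = tshift A (Suc n) y"
    "kk (def_couple A u) n X = cls S (Suc n) y"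
proof -
  let ?P = "\<lambda>y. y \<in> cc S (Suc n) \<and> (\<exists>c\<in>cc S n. c 0 = rep X \<and> cd S n c = tshift A (Suc n) y)"
  have x: "rep X \<in> cc A n" "cd A n (rep X) = cz A (Suc n)"
    using rep_cocycle[OF assms] by (auto simp: cocycles_def)
  \<comment> \<open>The constant series lifts \<open>rep X\<close>. Its \<open>D_t\<close> has
    constant term \<open>d (rep X) = 0\<close>, hence is divisible by \<open>t\<close>, so the
    choice in \<open>kk\<close> has a candidate.\<close>
  let ?c = "\<lambda>k::nat. if k = 0 then rep X else cz A n"
  have c: "?c \<in> cc S n" using x by simp
  have "cd S n ?c = tshift A (Suc n) (\<lambda>k. cd S n ?c (Suc k))"
  proof
    show "cd S n ?c k = tshift A (Suc n) (\<lambda>k. cd S n ?c (Suc k)) k" for k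
      using x by (cases k) (simp_all del: ser_d_Suc)
  qed
  moreover have "(\<lambda>k. cd S n ?c (Suc k)) \<in> cc S (Suc n)"
    using ser.d_closed[OF c] by (simp del: ser_d_Suc)
  ultimately have "\<exists>y. ?P y" using c by (intro exI conjI bexI[of _ ?c]) auto
  then have "?P (Eps ?P)" by (rule someI_ex)
  then show ?thesis using that by (auto simp: def_couple_def)
qed

lemma kk_eq:
  assumes "X \<in> H A n" and y: "y \<in> cc S (Suc n)" and c: "c \<in> cc S n" "c 0 = rep X"
    "cd S n c = tshift A (Suc n) y"
  shows "kk (def_couple A u) n X = cls S (Suc n) y"
proof -
  obtain y' c' where y': "y' \<in> cc S (Suc n)" and c': "c' \<in> cc S n" "c' 0 = rep X"
      "cd S n c' = tshift A (Suc n) y'" and kk: "kk (def_couple A u) n X = cls S (Suc n) y'"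
    using kk_rep[OF assms(1)] by metis
  \<comment> \<open>This is \<open>(c' - c) / t\<close>: both lifts start with \<open>rep X\<close>.
    Hence \<open>y' = y + D_t g\<close>, and the class does not depend on the lift.\<close>
  define g where "g = (\<lambda>k. ca A n (neg n (c (Suc k))) (c' (Suc k)))"
  have g: "g \<in> cc S n" using c c' by (simp add: g_def)
  have "c' k = ca S n c (tshift A n g) k" for k
    using c c' rep_cocycle[OF assms(1)] by (cases k) (auto simp: g_def cocycles_def)
  then have "c' = ca S n c (tshift A n g)" by blast
  then have "tshift A (Suc n) y' = tshift A (Suc n) (ca S (Suc n) y (cd S n g))"
    using c c' g ser.d_add[OF c(1) tshift_closed[OF g]] by (simp only: tshift_add d_tshift)
  then have "y' = ca S (Suc n) y (cd S n g)" by (simp only: tshift_inject)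
  then show ?thesis using kk ser.cls_add_coboundary[OF y ser.d_coboundary[OF g]] by simp
qed

text \<open>Turns an equation of classes into one of series: the discrepancy
  \<open>b = D_t g\<close> is absorbed by replacing the lift \<open>c\<close> with
  \<open>c + t g\<close>, which leaves the constant term unchanged.\<close>

lemma kk_eq_pow:
  assumes "X \<in> H A n" and f: "f \<in> cc S (Suc n)"
    and eq: "kk (def_couple A u) n X = cls S (Suc n) ((tshift A (Suc n) ^^ s) f)"
  obtains c where "c \<in> cc S n" "c 0 = rep X" "cd S n c = (tshift A (Suc n) ^^ Suc s) f"
proof -
  obtain y c where y: "y \<in> cc S (Suc n)" and c: "c \<in> cc S n" "c 0 = rep X"
      "cd S n c = tshift A (Suc n) y" and kk: "kk (def_couple A u) n X = cls S (Suc n) y"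
    using kk_rep[OF assms(1)] by metis
  obtain b where b: "b \<in> coboundaries S (Suc n)" "(tshift A (Suc n) ^^ s) f = ca S (Suc n) y b"
    using ser.cls_eqD[OF tshift_pow_closed[OF f]] eq kk by metis
  then obtain g where g: "g \<in> cc S n" "b = cd S n g" by (auto simp: coboundaries_def)
  show ?thesis
  proof (rule that)
    show "ca S n c (tshift A n g) \<in> cc S n" using c g ser.add_closed tshift_closed by blast
    show "ca S n c (tshift A n g) 0 = rep X"
      using c g rep_cocycle[OF assms(1)] by (simp add: cocycles_def)
    show "cd S n (ca S n c (tshift A n g)) = (tshift A (Suc n) ^^ Suc s) f"
      unfolding ser.d_add[OF c(1) tshift_closed[OF g(1)]] d_tshift[OF g(1)] c(3)
      using b g by (simp add: tshift_add del: ser_simps)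
  qed
qed

section \<open>The second term as kernel modulo image\<close>

lemma ec_Z_2: "ec_Z (def_couple A u) 2 n =
  {X \<in> H A n. mu (H_dga A) 1 n (cls A 1 u) X = cz (H_dga A) (Suc n)}"
proof -
  have "(\<exists>Y\<in>H S (Suc n). kk (def_couple A u) n X = ii (def_couple A u) (Suc n) Y)
      \<longleftrightarrow> cls A (Suc n) (mult1 n u (rep X)) = cls A (Suc n) (cz A (Suc n))" (is "?L \<longleftrightarrow> ?R")
    if X: "X \<in> H A n" for X
  proof
    have x: "rep X \<in> cc A n" "cd A n (rep X) = cz A (Suc n)"
      using rep_cocycle[OF X] by (auto simp: cocycles_def)
    {
      assume ?L
      then obtain f where f: "f \<in> cocycles S (Suc n)"
          "kk (def_couple A u) n X = ii (def_couple A u) (Suc n) (cls S (Suc n) f)"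
        by (auto simp only: H_def)
      have fc: "f \<in> cc S (Suc n)" using f ser.cocycle_closed by blast
      obtain c where c: "c \<in> cc S n" "c 0 = rep X" "cd S n c = (tshift A (Suc n) ^^ Suc 1) f"
        using kk_eq_pow[OF X fc, of 1] f(2) ii_cls[OF fc] by auto
      \<comment> \<open>The coefficient of \<open>t\<close> in \<open>D_t c\<close>, which is
        divisible by \<open>t^2\<close>.\<close>
      have "ca A (Suc n) (cd A n (c 1)) (mult1 n u (rep X)) = cz A (Suc n)"
        using c(2) fun_cong[OF c(3), of 1] by simp
      then have "mult1 n u (rep X) = neg (Suc n) (cd A n (c 1))"
        using c x by (intro neg_unique) auto
      then show ?R using c x by (simp add: cls_eq_zero_iff neg_coboundary)
    next
      assume ?R
      then have "neg (Suc n) (mult1 n u (rep X)) \<in> coboundaries A (Suc n)"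
        using x by (simp add: cls_eq_zero_iff neg_coboundary)
      then obtain e where e: "e \<in> cc A n" "cd A n e = neg (Suc n) (mult1 n u (rep X))"
        by (auto simp: coboundaries_def)
      \<comment> \<open>The lift \<open>rep X + t e\<close> satisfies
        \<open>D_t (rep X + t e) = t^2 (u e)\<close>, because \<open>d e = - u (rep X)\<close> kills
        the coefficient of \<open>t\<close>.\<close>
      let ?c = "\<lambda>k::nat. if k = 0 then rep X else if k = 1 then e else cz A n"
      let ?f = "\<lambda>k::nat. if k = 0 then mult1 n u e else cz A (Suc n)"
      have c: "?c \<in> cc S n" and f: "?f \<in> cc S (Suc n)" using x e by auto
      have dc: "cd S n ?c = tshift A (Suc n) (tshift A (Suc n) ?f)"
      proof
        fix k
        consider "k = 0" | "k = 1" | "k = 2" | j where "k = Suc (Suc (Suc j))"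
          by (metis One_nat_def Suc_1 not0_implies_Suc)
        then show "cd S n ?c k = tshift A (Suc n) (tshift A (Suc n) ?f) k"
          by cases (use x e in \<open>auto simp: numeral_2_eq_2\<close>)
      qed
      have tf: "tshift A (Suc n) ?f \<in> cc S (Suc n)" by (rule tshift_closed[OF f])
      have "tshift A (Suc n) ?f \<in> cocycles S (Suc n)"
        by (rule cocycle_if_tshift_coboundary[OF tf c dc])
      then have "cd S (Suc n) (tshift A (Suc n) ?f) = cz S (Suc (Suc n))"
        by (simp add: cocycles_def del: ser_simps)
      then have "tshift A (Suc (Suc n)) (cd S (Suc n) ?f) = tshift A (Suc (Suc n)) (cz S (Suc (Suc n)))"
        unfolding d_tshift[OF f] tshift_zero .
      then have "?f \<in> cocycles S (Suc n)"
        using f unfolding tshift_inject cocycles_def by blast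
      moreover have "kk (def_couple A u) n X = ii (def_couple A u) (Suc n) (cls S (Suc n) ?f)"
        unfolding ii_cls[OF f] by (rule kk_eq[OF X tf c _ dc]) simp
      ultimately show ?L using ser.cls_in_H by blast
    }
  qed
  then show ?thesis
    unfolding ec_Z_def using mult_H_dga[OF u, of _ n]
    by (intro Collect_cong conj_cong) (simp_all del: couple_simps(3-5) add: numeral_2_eq_2)
qed

text \<open>If \<open>t f = D_t g\<close>, then \<open>g_0\<close> is a cocycle and
  \<open>f_0 = d g_1 + u g_0\<close>. Conversely, the constant series \<open>rep X\<close> has
  \<open>D_t (rep X) = t (u (rep X))\<close>.\<close>

lemma ec_B_2_Suc: "ec_B (def_couple A u) 2 (Suc n) = (\<lambda>X. mu (H_dga A) 1 n (cls A 1 u) X) ` H A n"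
proof
  show "ec_B (def_couple A u) 2 (Suc n) \<subseteq> (\<lambda>X. mu (H_dga A) 1 n (cls A 1 u) X) ` H A n"
  proof
    fix Z assume "Z \<in> ec_B (def_couple A u) 2 (Suc n)"
    then obtain Y where Y: "Y \<in> H S (Suc n)" "ii (def_couple A u) (Suc n) Y = cls S (Suc n) (cz S (Suc n))"
        "Z = jj (def_couple A u) (Suc n) Y"
      by (auto simp: ec_B_def numeral_2_eq_2 simp del: couple_simps(4,5) ser_simps)
    define f where "f = rep Y"
    have fc: "f \<in> cc S (Suc n)" and Yf: "Y = cls S (Suc n) f"
      using ser.rep_cocycle[OF Y(1)] ser.cls_rep[OF Y(1)] ser.cocycle_closed unfolding f_def by auto
    have "tshift A (Suc n) f \<in> coboundaries S (Suc n)"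
      using Y(2) ser.cls_eq_zero_iff[OF tshift_closed[OF fc]] unfolding Yf ii_cls[OF fc] by blast
    then obtain g where g: "g \<in> cc S n" "tshift A (Suc n) f = cd S n g"
      by (auto simp: coboundaries_def)
    have g0: "g 0 \<in> cocycles A n"
      using g(1) fun_cong[OF g(2), of 0] by (simp add: cocycles_def)
    then have gc: "g 0 \<in> cc A n" by (rule cocycle_closed)
    have "f 0 = ca A (Suc n) (cd A n (g 1)) (mult1 n u (g 0))"
      using fun_cong[OF g(2), of 1] by simp
    then have "Z = cls A (Suc n) (mult1 n u (g 0))"
      using Y(3) Yf jj_cls[OF fc] g(1) by (simp add: cls_add_coboundary_left)
    also have "\<dots> = mu (H_dga A) 1 n (cls A 1 u) (cls A n (g 0))"
      by (rule mult_H_dga_cls[OF u g0, symmetric])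
    finally show "Z \<in> (\<lambda>X. mu (H_dga A) 1 n (cls A 1 u) X) ` H A n"
      using cls_in_H[OF g0] by blast
  qed
  show "(\<lambda>X. mu (H_dga A) 1 n (cls A 1 u) X) ` H A n \<subseteq> ec_B (def_couple A u) 2 (Suc n)"
  proof safe
    fix X assume X: "X \<in> H A n"
    have x: "rep X \<in> cc A n" "cd A n (rep X) = cz A (Suc n)"
      using rep_cocycle[OF X] by (auto simp: cocycles_def)
    let ?g = "\<lambda>k::nat. if k = 0 then rep X else cz A n"
    let ?f = "\<lambda>k::nat. if k = 0 then mult1 n u (rep X) else cz A (Suc n)"
    have g: "?g \<in> cc S n" and f: "?f \<in> cc S (Suc n)" using x by auto
    have dg: "cd S n ?g = tshift A (Suc n) ?f"
    proof
      fix k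
      consider "k = 0" | "k = 1" | j where "k = Suc (Suc j)"
        by (metis One_nat_def not0_implies_Suc)
      then show "cd S n ?g k = tshift A (Suc n) ?f k"
        by cases (use x in auto)
    qed
    have "?f \<in> cocycles S (Suc n)" by (rule cocycle_if_tshift_coboundary[OF f g dg])
    then have "cls S (Suc n) ?f \<in> H S (Suc n)" by (rule ser.cls_in_H)
    moreover have "ii (def_couple A u) (Suc n) (cls S (Suc n) ?f) = zD (def_couple A u) (Suc n)"
      unfolding ii_cls[OF f] couple_simps(3) ser.cls_eq_zero_iff[OF tshift_closed[OF f]]
      using ser.d_coboundary[OF g] unfolding dg .
    moreover have "mu (H_dga A) 1 n (cls A 1 u) X = jj (def_couple A u) (Suc n) (cls S (Suc n) ?f)"
      unfolding jj_cls[OF f] mult_H_dga[OF u X] by simp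
    ultimately show "mu (H_dga A) 1 n (cls A 1 u) X \<in> ec_B (def_couple A u) 2 (Suc n)"
      unfolding ec_B_def couple_simps(1)
      by (intro CollectI exI conjI)
        (auto simp only: diff_Suc_1 numeral_2_eq_2 comp_def funpow.simps id_apply)
  qed
qed

text \<open>Zero is the only coboundary in degree 0, so injectivity of \<open>t\<close> on series
  makes \<open>i\<close> have trivial kernel there.\<close>

lemma ec_B_2_0: "ec_B (def_couple A u) 2 0 = {cz (H_dga A) 0}"
proof
  have cls0: "cls S 0 (cz S 0) \<in> H S 0" by (rule ser.cls_in_H[OF ser.zero_cocycle])
  have jj0: "jj (def_couple A u) 0 (cls S 0 (cz S 0)) = cz (H_dga A) 0"
    unfolding jj_cls[OF ser.zero_closed] by simp
  have ii0: "ii (def_couple A u) 0 (cls S 0 (cz S 0)) = zD (def_couple A u) 0"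
    unfolding ii_cls[OF ser.zero_closed] tshift_zero by simp
  show "{cz (H_dga A) 0} \<subseteq> ec_B (def_couple A u) 2 0"
    unfolding ec_B_def couple_simps(1) using cls0 jj0 ii0
    by (auto simp del: couple_simps ser_simps H_dga_simps simp: numeral_2_eq_2)
  show "ec_B (def_couple A u) 2 0 \<subseteq> {cz (H_dga A) 0}"
  proof
    fix Z assume "Z \<in> ec_B (def_couple A u) 2 0"
    then obtain Y where Y: "Y \<in> H S 0" "ii (def_couple A u) 0 Y = cls S 0 (cz S 0)"
        "Z = jj (def_couple A u) 0 Y"
      by (auto simp: ec_B_def numeral_2_eq_2 simp del: couple_simps(4,5) ser_simps)
    define f where "f = rep Y"
    have fc: "f \<in> cc S 0" and Yf: "Y = cls S 0 f"
      using ser.rep_cocycle[OF Y(1)] ser.cls_rep[OF Y(1)] ser.cocycle_closed unfolding f_def by auto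
    have "tshift A 0 f \<in> coboundaries S 0"
      using Y(2) ser.cls_eq_zero_iff[OF tshift_closed[OF fc]] unfolding Yf ii_cls[OF fc] by blast
    then have "tshift A 0 f = tshift A 0 (cz S 0)"
      unfolding tshift_zero by (simp add: coboundaries_def)
    then have "f = cz S 0" by (simp only: tshift_inject)
    then show "Z \<in> {cz (H_dga A) 0}" using Y(3) Yf jj0 by simp
  qed
qed

section \<open>Vanishing of the higher differentials\<close>

lemma ec_B_mono:
  assumes "2 \<le> r"
  shows "ec_B (def_couple A u) 2 n \<subseteq> ec_B (def_couple A u) r n"
proof
  fix Z assume "Z \<in> ec_B (def_couple A u) 2 n"
  then obtain Y where Y: "Y \<in> H S n" "ii (def_couple A u) n Y = zD (def_couple A u) n"
      "Z = jj (def_couple A u) n Y"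
    by (auto simp: ec_B_def numeral_2_eq_2 simp del: couple_simps(3-5) ser_simps)
  have "(ii (def_couple A u) n ^^ s) (zD (def_couple A u) n) = zD (def_couple A u) n" for s
  proof (induction s)
    case (Suc s)
    have "ii (def_couple A u) n (zD (def_couple A u) n) = zD (def_couple A u) n"
      unfolding couple_simps(3) ii_cls[OF ser.zero_closed] tshift_zero ..
    then show ?case using Suc by simp
  qed simp
  moreover obtain s where "r - 1 = Suc s" using assms by (cases "r - 1") auto
  ultimately have "(ii (def_couple A u) n ^^ (r - 1)) Y = zD (def_couple A u) n"
    using Y(2) by (simp add: funpow_swap1 del: couple_simps)
  then show "Z \<in> ec_B (def_couple A u) r n" using Y by (auto simp: ec_B_def simp del: couple_simps(3-5))
qed

lemma dr_vanishes_if_mult_chain_end: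
  assumes mult: "\<And>n c. chain_end u n c \<Longrightarrow>
      \<exists>x\<in>cocycles A n. cls A (Suc n) (mult1 n u c) = cls A (Suc n) (mult1 n u x)"
    and r: "2 \<le> r"
  shows "dr_vanishes (def_couple A u) r"
  unfolding dr_vanishes_def
proof (intro allI ballI impI)
  fix n X Y
  assume X: "X \<in> ec_Z (def_couple A u) r n" and Y: "Y \<in> Dc (def_couple A u) (Suc n)"
    and kk: "kk (def_couple A u) n X = (ii (def_couple A u) (Suc n) ^^ (r - 1)) Y"
  obtain s where s: "r = Suc s" using r by (cases r) auto
  have XH: "X \<in> H A n" using X by (simp add: ec_Z_def)
  have YH: "Y \<in> H S (Suc n)" using Y by simp
  define f where "f = rep Y"
  have fc: "f \<in> cc S (Suc n)" and Yf: "Y = cls S (Suc n) f"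
    using ser.rep_cocycle[OF YH] ser.cls_rep[OF YH] ser.cocycle_closed unfolding f_def by auto
  have "kk (def_couple A u) n X = cls S (Suc n) ((tshift A (Suc n) ^^ s) f)"
    using kk unfolding Yf ii_pow_cls[OF fc] s by simp
  then obtain c where c: "c \<in> cc S n" "c 0 = rep X" "cd S n c = (tshift A (Suc n) ^^ Suc s) f"
    using kk_eq_pow[OF XH fc] by blast
  have ck: "c k \<in> cc A n" for k using c by simp
  \<comment> \<open>As \<open>D_t c = t^(s+1) f\<close>, the coefficients \<open>1\<close> to
    \<open>s\<close> of \<open>D_t c\<close> vanish, which are the chain equations up to
    \<open>c_s\<close>, where \<open>s = r - 1\<close>.\<close>
  have "chain_end u n (c k)" if "k \<le> s" for k
    using that
  proof (induction k)
    case 0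
    show ?case using c(2) rep_cocycle[OF XH] by (simp add: chain_end.cocycle)
  next
    case (Suc k)
    then have "ca A (Suc n) (cd A n (c (Suc k))) (mult1 n u (c k)) = cz A (Suc n)"
      using fun_cong[OF c(3), of "Suc k"] by (simp only: tshift_pow ser_d_Suc) auto
    then show ?case using Suc ck by (auto intro: chain_end.step)
  qed
  then have "chain_end u n (c s)" by simp
  then obtain x where x: "x \<in> cocycles A n" "cls A (Suc n) (mult1 n u (c s)) = cls A (Suc n) (mult1 n u x)"
    using mult by blast
  have xc: "x \<in> cc A n" using x cocycle_closed by blast
  \<comment> \<open>The first coefficient of \<open>D_t c\<close> that may be nonzero is number
    \<open>s + 1\<close>, and it equals \<open>f_0\<close>.\<close>
  have "f 0 = ca A (Suc n) (cd A n (c (Suc s))) (mult1 n u (c s))"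
    using fun_cong[OF c(3), of "Suc s"] by (simp only: tshift_pow ser_d_Suc) auto
  then have "jj (def_couple A u) (Suc n) Y = cls A (Suc n) (mult1 n u x)"
    unfolding Yf jj_cls[OF fc] using ck x(2) by (simp add: cls_add_coboundary_left)
  also have "\<dots> = mu (H_dga A) 1 n (cls A 1 u) (cls A n x)"
    by (rule mult_H_dga_cls[OF u x(1), symmetric])
  \<comment> \<open>Landing in \<open>B_2\<close> suffices: \<open>r - 1\<close> is at least 1, so
    the kernel of \<open>i\<close> lies in that of \<open>i^(r-1)\<close>.\<close>
  also have "\<dots> \<in> ec_B (def_couple A u) 2 (Suc n)"
    unfolding ec_B_2_Suc using cls_in_H[OF x(1)] by blast
  finally show "jj (def_couple A u) (Suc n) Y \<in> ec_B (def_couple A u) r (Suc n)"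
    using ec_B_mono[OF r] by blast
qed

end

theorem theorem3p14:
  fixes A :: "('k::field_char_0, 'a) dga" and M :: "('k, 'm) dga"
    and \<phi> :: "nat \<Rightarrow> 'm \<Rightarrow> 'a" and \<psi> :: "nat \<Rightarrow> 'm \<Rightarrow> 'a set" and \<xi> :: 'a
  assumes "cdga A"
    and "minimal_model M \<phi> A" and "minimal_model M \<psi> (H_dga A)"
    and "\<xi> \<in> cc A 1" and "cd A 1 \<xi> = cz A 2"
  shows "(\<forall>n. ec_Z (def_couple A \<xi>) 2 n =
            {X \<in> H A n. mu (H_dga A) 1 n (cls A 1 \<xi>) X = cz (H_dga A) (Suc n)}) \<and>
         (\<forall>n. ec_B (def_couple A \<xi>) 2 (Suc n) = (\<lambda>X. mu (H_dga A) 1 n (cls A 1 \<xi>) X) ` H A n) \<and>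
         ec_B (def_couple A \<xi>) 2 0 = {cz (H_dga A) 0} \<and>
         (\<forall>r\<ge>2. dr_vanishes (def_couple A \<xi>) r)"
proof -
  have \<xi>: "\<xi> \<in> cocycles A 1" using assms(4,5) by (simp add: cocycles_def numeral_2_eq_2)
  interpret deformation A \<xi> by unfold_locales (use assms(1) \<xi> in auto)
  have "\<exists>x\<in>cocycles A n. cls A (Suc n) (mult1 n \<xi> c) = cls A (Suc n) (mult1 n \<xi> x)"
    if "chain_end \<xi> n c" for n c
    using formal_mult_chain_end[OF assms(1) _ _ _ \<xi> that, of M \<phi> \<psi>] assms(2,3)
    by (auto simp: minimal_model_def)
  then show ?thesis
    by (intro conjI allI impI ec_Z_2 ec_B_2_Suc ec_B_2_0 dr_vanishes_if_mult_chain_end)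
qed

end
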